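(* Let $k\ge5$ be an integer, and define $\sigma(k):=\max\{2^{-4-24/(k-5)},\ 1/2-\sqrt{48/k}\}$ for $k\ge6$ and $\sigma(5):=1/30$. For the extremist rule of order $k$ we have $\theta(k)\ge\sigma(k)>0$.
   Context: Let $(\Omega,\pi)$ be an atomless probability space with separable $\sigma$-algebra. A kernel is a bounded symmetric measurable $W:\Omega^2\to\mathbb{R}$; $\mathcal{W}$ is the Banach space of kernels with $\|\cdot\|_\infty$; graphons are kernels with values in $[0,1]$; $\mathcal{W}_0$ is the set of graphons; $0$ denotes the constant-$0$ graphon; $\|W\|_1=\int|W|\,d\pi^2$; $d_\square(U,W)=\sup_{S,T\subseteq\Omega}|\int_{S\times T}(U-W)\,d\pi^2|$. For $k\in\mathbb{N}$, $\mathcal{H}_k$ is the set of graphs on $[k]$. A rule of order $k$ is a matrix $\mathcal{R}\in[0,1]^{\mathcal{H}_k\times\mathcal{H}_k}$ with row sums $1$. For a kernel $W$, $F\in\mathcal{H}_k$, distinct $a,b$, $x,y$: $t^{x,y}_{\mathrm{ind}}(F^{a,b},W)=\int\prod_{ij\in E(F)}W(x_i,x_j)\prod_{ij\notin E(F)}(1-W(x_i,x_j))\prod_{i\ne a,b}d\pi(x_i)$ with $x_a=x,x_b=y$. Velocity: $\mathfrak{V}_{\mathcal{R}}W(x,y)=\sum_{F,H}\sum_{a\ne b}\mathcal{R}_{F,H}t^{x,y}_{\mathrm{ind}}(F^{a,b},W)(\mathbb{1}[ab\in E(H)\setminus E(F)]-\mathbb{1}[ab\in E(F)\setminus E(H)])$.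 For a graphon $W$ the trajectory $t\mapsto\Phi^tW$, $t\ge0$, is the unique solution of $\frac{d}{dt}\Phi^tW=\mathfrak{V}_{\mathcal{R}}(\Phi^tW)$ in $(\mathcal{W},\|\cdot\|_\infty)$ with $\Phi^0W=W$; $\mathrm{dest}(W)$ is the graphon $S$ (if it exists) with $d_\square(\Phi^tW,S)\to0$ as $t\to\infty$. The extremist rule of order $k$: $\mathcal{R}_{F,\overline{K_k}}=1$ if $e(F)<\frac12\binom k2$; $\mathcal{R}_{F,K_k}=1$ if $e(F)>\frac12\binom k2$; $\mathcal{R}_{F,F}=1$ if $e(F)=\frac12\binom k2$; other entries $0$. The density threshold is $\theta(k):=\sup\{p\in[0,1]:\forall W\in\mathcal{W}_0,\ \|W\|_1\le p\Rightarrow\mathrm{dest}(W)=0\}$. *)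

theory Defs
  imports "HOL-Probability.Probability"
begin

subsection \<open>The ground space\<close>

definition atomless :: "'a measure \<Rightarrow> bool" where
  "atomless M \<longleftrightarrow>
     (\<forall>A\<in>sets M. 0 < measure M A \<longrightarrow>
        (\<exists>B\<in>sets M. B \<subseteq> A \<and> 0 < measure M B \<and> measure M B < measure M A))"

text \<open>Separability of the \<open>\<sigma>\<close>-algebra under the pseudometric \<open>(A, B) \<mapsto> \<pi>(A \<triangle> B)\<close>;
  every countably generated \<open>\<sigma>\<close>-algebra satisfies it.\<close>

definition separable_sigma_algebra :: "'a measure \<Rightarrow> bool" where
  "separable_sigma_algebra M \<longleftrightarrow>
     (\<exists>\<D>. countable \<D> \<and> \<D> \<subseteq> sets M \<and>
        (\<forall>A\<in>sets M. \<forall>\<epsilon>>0. \<exists>D\<in>\<D>. measure M ((A - D) \<union> (D - A)) < \<epsilon>))"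

subsection \<open>Kernels and graphons\<close>

text \<open>Elements of the Banach space of kernels are represented by functions; two functions that
  agree almost everywhere represent the same kernel.\<close>

definition kernel :: "'a measure \<Rightarrow> ('a \<times> 'a \<Rightarrow> real) \<Rightarrow> bool" where
  "kernel M W \<longleftrightarrow>
     W \<in> borel_measurable (M \<Otimes>\<^sub>M M) \<and>
     (\<exists>B. \<forall>z\<in>space (M \<Otimes>\<^sub>M M). \<bar>W z\<bar> \<le> B) \<and>
     (\<forall>x\<in>space M. \<forall>y\<in>space M. W (x, y) = W (y, x))"

definition graphon :: "'a measure \<Rightarrow> ('a \<times> 'a \<Rightarrow> real) \<Rightarrow> bool" where
  "graphon M W \<longleftrightarrow> kernel M W \<and> (\<forall>z\<in>space (M \<Otimes>\<^sub>M M). W z \<in> {0..1})"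

text \<open>Extended-real valued, so that no function of infinite norm is assigned a finite value.\<close>

definition norm_infty :: "'a measure \<Rightarrow> ('a \<times> 'a \<Rightarrow> real) \<Rightarrow> ereal" where
  "norm_infty M W = esssup (M \<Otimes>\<^sub>M M) (\<lambda>z. ereal \<bar>W z\<bar>)"

definition norm_one :: "'a measure \<Rightarrow> ('a \<times> 'a \<Rightarrow> real) \<Rightarrow> real" where
  "norm_one M W = (LINT z|(M \<Otimes>\<^sub>M M). \<bar>W z\<bar>)"

definition cut_distance ::
  "'a measure \<Rightarrow> ('a \<times> 'a \<Rightarrow> real) \<Rightarrow> ('a \<times> 'a \<Rightarrow> real) \<Rightarrow> real" where
  "cut_distance M U W =
     (SUP (S, T) \<in> sets M \<times> sets M. \<bar>LINT z:(S \<times> T)|(M \<Otimes>\<^sub>M M). (U z - W z)\<bar>)"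

subsection \<open>Graphs on \<open>[k]\<close> and rules\<close>

text \<open>A graph on \<open>{1..k}\<close> is identified with its set of edges.\<close>

type_synonym graph = "nat set set"

definition clique_graph :: "nat \<Rightarrow> graph" where
  "clique_graph k = {e. e \<subseteq> {1..k} \<and> card e = 2}"

definition graphs :: "nat \<Rightarrow> graph set" where
  "graphs k = Pow (clique_graph k)"

definition is_rule :: "nat \<Rightarrow> (graph \<Rightarrow> graph \<Rightarrow> real) \<Rightarrow> bool" where
  "is_rule k R \<longleftrightarrow>
     (\<forall>F\<in>graphs k. \<forall>H\<in>graphs k. R F H \<in> {0..1}) \<and>
     (\<forall>F\<in>graphs k. (\<Sum>H\<in>graphs k. R F H) = 1)"

definition extremist_rule :: "nat \<Rightarrow> graph \<Rightarrow> graph \<Rightarrow> real" where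
  "extremist_rule k F H =
     (if real (card F) < 1/2 * real (k choose 2) then of_bool (H = {})
      else if real (card F) > 1/2 * real (k choose 2) then of_bool (H = clique_graph k)
      else of_bool (H = F))"

lemma finite_graphs: "finite (graphs k)"
proof -
  have "clique_graph k \<subseteq> Pow {1..k}" by (auto simp: clique_graph_def)
  then show ?thesis by (simp add: graphs_def finite_subset)
qed

lemma is_rule_extremist: "is_rule k (extremist_rule k)"
proof -
  have "(\<Sum>H\<in>graphs k. extremist_rule k F H) = 1" if "F \<in> graphs k" for F
  proof -
    have one: "(\<Sum>H\<in>graphs k. of_bool (H = G)) = (1::real)" if "G \<in> graphs k" for G
      using that finite_graphs[of k] by (simp add: of_bool_def sum.delta)
    have "{} \<in> graphs k" "clique_graph k \<in> graphs k" by (auto simp: graphs_def)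
    then show ?thesis
      using one that unfolding extremist_rule_def
      by (cases "real (card F) < 1/2 * real (k choose 2)";
          cases "real (card F) > 1/2 * real (k choose 2)") (simp_all only: if_True if_False)
  qed
  then show ?thesis by (simp add: is_rule_def extremist_rule_def)
qed

subsection \<open>Velocity, trajectories and destinations\<close>

text \<open>For a symmetric \<open>W\<close> the factor of an unordered pair \<open>ij\<close> does not depend on its
  orientation; it is evaluated at \<open>i < j\<close>.\<close>

definition ind_weight ::
  "nat \<Rightarrow> graph \<Rightarrow> ('a \<times> 'a \<Rightarrow> real) \<Rightarrow> (nat \<Rightarrow> 'a) \<Rightarrow> real" where
  "ind_weight k F W \<xi> =
     (\<Prod>(i, j) \<in> {(i, j). i \<in> {1..k} \<and> j \<in> {1..k} \<and> i < j}.
        if {i, j} \<in> F then W (\<xi> i, \<xi> j) else 1 - W (\<xi> i, \<xi> j))"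

definition rooted_ind_density ::
  "'a measure \<Rightarrow> nat \<Rightarrow> graph \<Rightarrow> nat \<Rightarrow> nat \<Rightarrow> ('a \<times> 'a \<Rightarrow> real) \<Rightarrow> 'a \<times> 'a \<Rightarrow> real" where
  "rooted_ind_density M k F a b W = (\<lambda>(x, y).
     LINT \<xi>|(Pi\<^sub>M ({1..k} - {a, b}) (\<lambda>_. M)). ind_weight k F W (\<xi>(a := x, b := y)))"

definition velocity ::
  "'a measure \<Rightarrow> nat \<Rightarrow> (graph \<Rightarrow> graph \<Rightarrow> real) \<Rightarrow> ('a \<times> 'a \<Rightarrow> real) \<Rightarrow> 'a \<times> 'a \<Rightarrow> real" where
  "velocity M k R W z =
     (\<Sum>F\<in>graphs k. \<Sum>H\<in>graphs k. \<Sum>a\<in>{1..k}. \<Sum>b\<in>{1..k} - {a}.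
        R F H * rooted_ind_density M k F a b W z *
        (of_bool ({a, b} \<in> H - F) - of_bool ({a, b} \<in> F - H)))"

text \<open>Forward solutions of the differential equation, the derivative being taken in
  \<open>\<parallel>\<cdot>\<parallel>\<^sub>\<infinity>\<close> (one-sided at time \<open>0\<close>).\<close>

definition is_trajectory ::
  "'a measure \<Rightarrow> nat \<Rightarrow> (graph \<Rightarrow> graph \<Rightarrow> real) \<Rightarrow> ('a \<times> 'a \<Rightarrow> real) \<Rightarrow>
   (real \<Rightarrow> 'a \<times> 'a \<Rightarrow> real) \<Rightarrow> bool" where
  "is_trajectory M k R W \<Phi> \<longleftrightarrow>
     (\<forall>t\<ge>0. kernel M (\<Phi> t)) \<and>
     (AE z in M \<Otimes>\<^sub>M M. \<Phi> 0 z = W z) \<and>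
     (\<forall>t\<ge>0. ((\<lambda>s. norm_infty M (\<lambda>z. (\<Phi> s z - \<Phi> t z) / (s - t) - velocity M k R (\<Phi> t) z))
        \<longlongrightarrow> 0) (at t within {0..}))"

text \<open>\<open>has_dest M k R W S\<close> renders \<open>dest(W) = S\<close>, including the existence of the trajectory and of
  its limit. Destinations are determined up to null sets only, hence a relation.\<close>

definition has_dest ::
  "'a measure \<Rightarrow> nat \<Rightarrow> (graph \<Rightarrow> graph \<Rightarrow> real) \<Rightarrow> ('a \<times> 'a \<Rightarrow> real) \<Rightarrow>
   ('a \<times> 'a \<Rightarrow> real) \<Rightarrow> bool" where
  "has_dest M k R W S \<longleftrightarrow> graphon M S \<and>
     (\<exists>\<Phi>. is_trajectory M k R W \<Phi> \<and> ((\<lambda>t. cut_distance M (\<Phi> t) S) \<longlongrightarrow> 0) at_top)"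

definition density_threshold :: "'a measure \<Rightarrow> nat \<Rightarrow> real" where
  "density_threshold M k =
     Sup {p \<in> {0..1}. \<forall>W. graphon M W \<and> norm_one M W \<le> p \<longrightarrow>
            has_dest M k (extremist_rule k) W (\<lambda>_. 0)}"

definition threshold_bound :: "nat \<Rightarrow> real" where
  "threshold_bound k =
     (if k = 5 then 1/30
      else max (2 powr (- 4 - 24 / (real k - 5))) (1/2 - sqrt (48 / real k)))"

end

theory Submission
  imports Defs
begin

text \<open>Sampling \<open>k\<close> vertices from a graphon of density \<open>p\<close> gives a random graph with \<open>X\<close> edges,
  and along a trajectory \<open>p' \<le> 2 N (P(X \<ge> N/2) - p)\<close> with \<open>N = k choose 2\<close>. Vertex-disjoint edges
  of the sample are independent, so the expected number of ordered pairs of disjoint edges is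
  \<open>N ((k - 2) choose 2) p\<^sup>2\<close>. A graph with at least \<open>N/2\<close> edges has many such pairs, which bounds
  \<open>P(X \<ge> N/2)\<close> by a multiple of \<open>p\<^sup>2\<close>; for densities close to \<open>1/2\<close> and large \<open>k\<close>, Chebyshev's
  inequality applies, since only the few intersecting pairs contribute to the variance. Both ways
  \<open>P(X \<ge> N/2) \<le> 7/8 p\<close> below the threshold, and \<open>p\<close> decays exponentially.

  The trajectory is the limit of explicit Euler schemes with dyadic step sizes. They stay inside the
  graphons because the velocity lies between \<open>- Q W\<close> and \<open>Q (1 - W)\<close> for a constant \<open>Q\<close>, and the
  decay of the density is proved for them directly, by induction on the number of steps.\<close>

section \<open>Euler schemes for a vector field on an invariant set of functions\<close>

primrec euler_iterate ::
  "(('b \<Rightarrow> real) \<Rightarrow> 'b \<Rightarrow> real) \<Rightarrow> real \<Rightarrow> ('b \<Rightarrow> real) \<Rightarrow> nat \<Rightarrow> 'b \<Rightarrow> real" where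
  "euler_iterate V h w 0 = w"
| "euler_iterate V h w (Suc j) = (\<lambda>z. euler_iterate V h w j z + h * V (euler_iterate V h w j) z)"

text \<open>All estimates are pointwise on \<open>Z\<close>, not almost everywhere, so each point
  can be followed separately. Invariance is imposed through \<open>step_mem\<close>, for single
  Euler steps; \<open>lipschitz\<close> refers to the uniform distance on \<open>Z\<close>.\<close>

locale invariant_vector_field =
  fixes V :: "('b \<Rightarrow> real) \<Rightarrow> 'b \<Rightarrow> real" and K :: "('b \<Rightarrow> real) set" and Z :: "'b set"
    and h\<^sub>0 L C :: real
  assumes h\<^sub>0_pos: "0 < h\<^sub>0"
    and L_nonneg: "0 \<le> L" and C_nonneg: "0 \<le> C"
    and step_mem: "\<And>f h. f \<in> K \<Longrightarrow> 0 \<le> h \<Longrightarrow> h \<le> h\<^sub>0 \<Longrightarrow> (\<lambda>z. f z + h * V f z) \<in> K"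
    and bound: "\<And>f z. f \<in> K \<Longrightarrow> z \<in> Z \<Longrightarrow> \<bar>V f z\<bar> \<le> L"
    and lipschitz: "\<And>f g d z. f \<in> K \<Longrightarrow> g \<in> K \<Longrightarrow> (\<And>y. y \<in> Z \<Longrightarrow> \<bar>f y - g y\<bar> \<le> d) \<Longrightarrow>
      z \<in> Z \<Longrightarrow> \<bar>V f z - V g z\<bar> \<le> C * d"
    and closed: "\<And>F f. (\<And>n::nat. F n \<in> K) \<Longrightarrow> (\<And>z. z \<in> Z \<Longrightarrow> (\<lambda>n. F n z) \<longlonglongrightarrow> f z) \<Longrightarrow> f \<in> K"
begin

text \<open>Halving makes every grid contain the previous one, and starting from
  \<open>h\<^sub>0\<close> keeps each step admissible for \<open>step_mem\<close>.\<close>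

definition mesh :: "nat \<Rightarrow> real" where
  "mesh m = h\<^sub>0 / 2 ^ m"

lemma mesh_pos: "0 < mesh m" and mesh_le: "mesh m \<le> h\<^sub>0" and mesh_Suc: "mesh (Suc m) = mesh m / 2"
  using h\<^sub>0_pos by (simp_all add: mesh_def divide_le_eq)

lemma mesh_LIMSEQ: "mesh \<longlonglongrightarrow> 0"
  unfolding mesh_def by (rule LIMSEQ_divide_realpow_zero) simp

text \<open>A step function of time, without interpolation: the value at \<open>t\<close> is the
  iterate at the last grid point not after \<open>t\<close>. So every value lies in
  \<open>K\<close>, although \<open>K\<close> is not assumed convex.\<close>

definition polygon :: "('b \<Rightarrow> real) \<Rightarrow> nat \<Rightarrow> real \<Rightarrow> 'b \<Rightarrow> real" where
  "polygon w m t = euler_iterate V (mesh m) w (nat \<lfloor>t / mesh m\<rfloor>)"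

lemma euler_iterate_mem: "w \<in> K \<Longrightarrow> 0 \<le> h \<Longrightarrow> h \<le> h\<^sub>0 \<Longrightarrow> euler_iterate V h w j \<in> K"
  by (induction j) (auto intro: step_mem)

lemma polygon_mem: "w \<in> K \<Longrightarrow> polygon w m t \<in> K"
  unfolding polygon_def using mesh_pos[of m] mesh_le[of m] by (intro euler_iterate_mem) auto

lemma euler_iterate_diff:
  assumes "w \<in> K" "0 \<le> h" "h \<le> h\<^sub>0" "z \<in> Z"
  shows "\<bar>euler_iterate V h w (i + n) z - euler_iterate V h w i z\<bar> \<le> L * (real n * h)"
proof (induction n)
  case (Suc n)
  have "\<bar>h * V (euler_iterate V h w (i + n)) z\<bar> \<le> h * L"
    using bound[OF euler_iterate_mem[OF assms(1-3)] assms(4)] assms(2)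
    by (simp add: abs_mult mult_left_mono)
  with Suc show ?case by (simp add: algebra_simps abs_le_iff)
qed simp

text \<open>The iterates differ from one long step only because \<open>V\<close> is re-evaluated
  along the way, at points that have moved by at most \<open>L\<close> times the elapsed time. The
  error is quadratic in the elapsed time with a constant free of \<open>h\<close>, so it survives
  refinement.\<close>

lemma euler_iterate_taylor:
  assumes "w \<in> K" "0 \<le> h" "h \<le> h\<^sub>0" "z \<in> Z"
  shows "\<bar>euler_iterate V h w (i + n) z - euler_iterate V h w i z
      - real n * h * V (euler_iterate V h w i) z\<bar> \<le> C * L * (real n * h)\<^sup>2"
proof (induction n)
  case (Suc n)
  let ?e = "euler_iterate V h w"
  have "\<bar>V (?e (i + n)) z - V (?e i) z\<bar> \<le> C * (L * (real n * h))"
    using assms by (intro lipschitz euler_iterate_mem euler_iterate_diff)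
  then have "\<bar>h * (V (?e (i + n)) z - V (?e i) z)\<bar> \<le> h * (C * (L * (real n * h)))"
    using assms(2) by (simp add: abs_mult mult_left_mono)
  moreover have "?e (i + Suc n) z - ?e i z - real (Suc n) * h * V (?e i) z =
      (?e (i + n) z - ?e i z - real n * h * V (?e i) z) + h * (V (?e (i + n)) z - V (?e i) z)"
    by (simp add: algebra_simps)
  \<comment> \<open>This is n^2 + n <= (n + 1)^2, scaled by
    \<open>C * L * h\<^sup>2\<close>.\<close>
  moreover have "C * L * (real n * h)\<^sup>2 + h * (C * (L * (real n * h)))
      \<le> C * L * (real (Suc n) * h)\<^sup>2"
  proof -
    have "(real n * h)\<^sup>2 + h * (real n * h) \<le> (real (Suc n) * h)\<^sup>2"
      using assms(2) by (simp add: power2_eq_square algebra_simps)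
    then have "C * L * ((real n * h)\<^sup>2 + h * (real n * h)) \<le> C * L * (real (Suc n) * h)\<^sup>2"
      using L_nonneg C_nonneg by (intro mult_left_mono) auto
    then show ?thesis by (simp add: algebra_simps)
  qed
  ultimately show ?case using Suc by linarith
qed simp

text \<open>Two half steps differ from a full step by the old error and by the drift to the
  midpoint, at most L h / 2. A discrete Gronwall argument sums these contributions.\<close>

lemma euler_iterate_halve:
  assumes "w \<in> K" "0 \<le> h" "h \<le> h\<^sub>0" "z \<in> Z"
  shows "\<bar>euler_iterate V (h / 2) w (2 * j) z - euler_iterate V h w j z\<bar>
      \<le> L * h * ((1 + C * h) ^ j - 1)"
  using assms(4)
proof (induction j arbitrary: z)
  case (Suc j)
  let ?f = "euler_iterate V (h / 2) w" and ?e = "euler_iterate V h w"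
  let ?D = "L * h * ((1 + C * h) ^ j - 1)"
  have fK: "?f i \<in> K" and eK: "?e i \<in> K" for i
    using assms by (auto intro: euler_iterate_mem)
  have one: "\<bar>?f (Suc (2 * j)) y - ?f (2 * j) y\<bar> \<le> L * (h / 2)" if "y \<in> Z" for y
    using euler_iterate_diff[of w "h / 2" y "2 * j" 1] assms that by simp
  have "\<bar>?f (Suc (2 * j)) y - ?e j y\<bar> \<le> L * (h / 2) + ?D" if "y \<in> Z" for y
    using one[OF that] Suc.IH[OF that] by linarith
  then have "\<bar>V (?f (Suc (2 * j))) z - V (?e j) z\<bar> \<le> C * (L * (h / 2) + ?D)"
    using fK eK Suc.prems by (intro lipschitz)
  moreover have "\<bar>V (?f (2 * j)) z - V (?e j) z\<bar> \<le> C * ?D"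
    using fK eK Suc.prems Suc.IH by (intro lipschitz)
  ultimately have "\<bar>(V (?f (Suc (2 * j))) z - V (?e j) z) + (V (?f (2 * j)) z - V (?e j) z)\<bar>
      \<le> C * (L * (h / 2) + ?D) + C * ?D"
    by linarith
  then have "h / 2 * \<bar>(V (?f (Suc (2 * j))) z - V (?e j) z) + (V (?f (2 * j)) z - V (?e j) z)\<bar>
      \<le> h / 2 * (C * (L * (h / 2) + ?D) + C * ?D)"
    using assms(2) by (intro mult_left_mono) auto
  then have step: "\<bar>h / 2 * ((V (?f (Suc (2 * j))) z - V (?e j) z) + (V (?f (2 * j)) z
      - V (?e j) z))\<bar>
      \<le> h / 2 * (C * (L * (h / 2) + ?D) + C * ?D)"
    using assms(2) by (simp add: abs_mult)
  have "?f (2 * Suc j) z - ?e (Suc j) z = (?f (2 * j) z - ?e j z)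
      + h / 2 * ((V (?f (Suc (2 * j))) z - V (?e j) z) + (V (?f (2 * j)) z - V (?e j) z))"
    by (simp add: field_simps)
  then have "\<bar>?f (2 * Suc j) z - ?e (Suc j) z\<bar> \<le> ?D + h / 2 * (C * (L * (h / 2) + ?D) + C * ?D)"
    using step Suc.IH[OF Suc.prems] by linarith
  \<comment> \<open>The claimed bound satisfies D(j+1) = (1 + C h) D(j) + C L h^2, whereas one step
    only costs C L h^2 / 4; the subtracted term is the slack.\<close>
  also have "\<dots> = L * h * ((1 + C * h) ^ Suc j - 1) - 3 / 4 * (C * L * h\<^sup>2)"
    by (simp add: power2_eq_square field_simps)
  also have "\<dots> \<le> L * h * ((1 + C * h) ^ Suc j - 1)"
    using L_nonneg C_nonneg by simp
  finally show ?case .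
qed simp

lemma polygon_Suc:
  assumes "w \<in> K" "0 \<le> t" "z \<in> Z"
  shows "\<bar>polygon w (Suc m) t z - polygon w m t z\<bar> \<le> L * h\<^sub>0 * (exp (C * t) + 1) / 2 ^ m"
proof -
  define h where "h = mesh m"
  have h: "0 < h" "h \<le> h\<^sub>0" unfolding h_def by (rule mesh_pos mesh_le)+
  define j where "j = nat \<lfloor>t / h\<rfloor>"
  define j' where "j' = nat \<lfloor>t / (h / 2)\<rfloor>"
  have j: "real j \<le> t / h" using assms(2) h by (simp add: j_def)
  \<comment> \<open>The finer grid may contain one more point before \<open>t\<close>; the extra
    half step moves the iterate by at most L h.\<close>
  have "\<lfloor>t / (h / 2)\<rfloor> = 2 * \<lfloor>t / h\<rfloor> \<or> \<lfloor>t / (h / 2)\<rfloor> = 2 * \<lfloor>t / h\<rfloor> + 1"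
  proof -
    have "\<lfloor>2 * x\<rfloor> = 2 * \<lfloor>x\<rfloor> \<or> \<lfloor>2 * x\<rfloor> = 2 * \<lfloor>x\<rfloor> + 1" for x :: real by linarith
    from this[of "t / h"] show ?thesis by (simp add: mult.commute)
  qed
  moreover have "0 \<le> \<lfloor>t / h\<rfloor>" using assms(2) h by simp
  ultimately have j': "j' = 2 * j + 0 \<or> j' = 2 * j + 1"
    unfolding j_def j'_def by (auto simp: nat_mult_distrib nat_add_distrib)
  let ?f = "euler_iterate V (h / 2) w" and ?e = "euler_iterate V h w"
  have "\<bar>?f j' z - ?f (2 * j) z\<bar> \<le> L * h"
    using euler_iterate_diff[of w "h/2" z "2 * j" 0] euler_iterate_diff[of w "h/2" z "2 * j" 1]
      j' h assms L_nonneg mult_nonneg_nonneg[of L h] by auto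
  moreover have "\<bar>?f (2 * j) z - ?e j z\<bar> \<le> L * h * ((1 + C * h) ^ j - 1)"
    using h assms by (intro euler_iterate_halve) auto
  \<comment> \<open>Since j h <= t, the Gronwall factor is at most exp (C t) at every level, which
    leaves a bound that is geometric in \<open>m\<close>.\<close>
  moreover have "L * h * ((1 + C * h) ^ j - 1) \<le> L * h * exp (C * t)"
  proof -
    have "(1 + C * h) ^ j \<le> exp (C * h) ^ j"
      using h C_nonneg by (intro power_mono) (auto intro: add_nonneg_nonneg)
    also have "\<dots> = exp (C * (h * real j))" by (simp add: exp_of_nat_mult[symmetric] mult_ac)
    also have "\<dots> \<le> exp (C * t)"
      using j h C_nonneg by (auto simp: field_simps intro!: mult_left_mono)
    finally show ?thesis using L_nonneg h by (intro mult_left_mono) auto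
  qed
  ultimately have "\<bar>?f j' z - ?e j z\<bar> \<le> L * h * (exp (C * t) + 1)"
    by (simp add: algebra_simps abs_le_iff) linarith
  then show ?thesis
    by (simp add: polygon_def mesh_Suc h_def j_def j'_def) (simp add: mesh_def)
qed

section \<open>The limiting flow and its first-order expansion in time\<close>

definition flow :: "('b \<Rightarrow> real) \<Rightarrow> real \<Rightarrow> 'b \<Rightarrow> real" where
  "flow w t z = lim (\<lambda>m. polygon w m t z)"

lemma polygon_diff:
  assumes "w \<in> K" "0 \<le> t" "z \<in> Z"
  shows "\<bar>polygon w (m + n) t z - polygon w m t z\<bar>
      \<le> L * h\<^sub>0 * (exp (C * t) + 1) * (2 / 2 ^ m - 2 / 2 ^ (m + n))"
proof (induction n)
  case (Suc n)
  let ?A = "L * h\<^sub>0 * (exp (C * t) + 1)"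
  \<comment> \<open>Writing the increment as a difference makes the geometric bounds
    telescope.\<close>
  have "?A / 2 ^ (m + n) = ?A * (2 / 2 ^ (m + n) - 2 / 2 ^ (m + Suc n))" by simp
  then have "\<bar>polygon w (m + Suc n) t z - polygon w (m + n) t z\<bar>
      \<le> ?A * (2 / 2 ^ (m + n) - 2 / 2 ^ (m + Suc n))"
    using polygon_Suc[OF assms, of "m + n"] by simp
  with Suc show ?case unfolding right_diff_distrib by linarith
qed simp

lemma polygon_LIMSEQ:
  assumes "w \<in> K" "0 \<le> t" "z \<in> Z"
  shows "(\<lambda>m. polygon w m t z) \<longlonglongrightarrow> flow w t z"
proof -
  let ?A = "L * h\<^sub>0 * (exp (C * t) + 1)"
  have "summable (\<lambda>m. polygon w (Suc m) t z - polygon w m t z)"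
  proof (rule summable_comparison_test')
    show "summable (\<lambda>m. ?A * (1 / 2) ^ m)"
      by (intro summable_mult summable_geometric) simp
    show "norm (polygon w (Suc m) t z - polygon w m t z) \<le> ?A * (1 / 2) ^ m" for m
      using polygon_Suc[OF assms, of m] by (simp add: power_divide)
  qed
  then have "convergent (\<lambda>m. polygon w m t z)"
    by (simp add: summable_iff_convergent sum_lessThan_telescope[of "\<lambda>m. polygon w m t z"]
        convergent_diff_const_right_iff)
  then show ?thesis by (simp add: convergent_LIMSEQ_iff flow_def)
qed

text \<open>Letting \<open>n\<close> tend to infinity in \<open>polygon_diff\<close> gives a rate
  that does not depend on the point of \<open>Z\<close>.\<close>

lemma polygon_flow_diff:
  assumes "w \<in> K" "0 \<le> t" "z \<in> Z"
  shows "\<bar>polygon w m t z - flow w t z\<bar> \<le> L * h\<^sub>0 * (exp (C * t) + 1) * (2 / 2 ^ m)"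
proof (rule LIMSEQ_le_const2)
  show "(\<lambda>n. \<bar>polygon w m t z - polygon w n t z\<bar>) \<longlonglongrightarrow> \<bar>polygon w m t z - flow w t z\<bar>"
    by (intro tendsto_intros polygon_LIMSEQ assms)
  show "\<exists>N. \<forall>n\<ge>N. \<bar>polygon w m t z - polygon w n t z\<bar> \<le> L * h\<^sub>0 * (exp (C * t) + 1) * (2 / 2 ^ m)"
  proof (intro exI[of _ m] allI impI)
    fix n assume "m \<le> n"
    then obtain d where n: "n = m + d" using le_Suc_ex by blast
    have "L * h\<^sub>0 * (exp (C * t) + 1) * (2 / 2 ^ m - 2 / 2 ^ (m + d))
        \<le> L * h\<^sub>0 * (exp (C * t) + 1) * (2 / 2 ^ m)"
      using L_nonneg h\<^sub>0_pos by (intro mult_left_mono) (auto intro!: mult_nonneg_nonneg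
          add_nonneg_nonneg)
    then show "\<bar>polygon w m t z - polygon w n t z\<bar> \<le> L * h\<^sub>0 * (exp (C * t) + 1) * (2 / 2 ^ m)"
      using polygon_diff[OF assms, of m d] by (simp add: n abs_minus_commute)
  qed
qed

text \<open>The limit is controlled only on \<open>Z\<close>, which is all that
  \<open>closed\<close> asks for.\<close>

lemma flow_mem: "w \<in> K \<Longrightarrow> 0 \<le> t \<Longrightarrow> flow w t \<in> K"
  by (rule closed[of "\<lambda>m. polygon w m t"]) (auto intro: polygon_mem polygon_LIMSEQ)

lemma flow_0: "flow w 0 = w"
  by (simp add: flow_def polygon_def fun_eq_iff)

text \<open>Pointwise convergence of the arguments would not suffice, as \<open>V\<close> may depend
  on the whole function; the uniform rate of \<open>polygon_flow_diff\<close> makes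
  \<open>lipschitz\<close> applicable.\<close>

lemma V_polygon_LIMSEQ:
  assumes "w \<in> K" "0 \<le> t" "z \<in> Z"
  shows "(\<lambda>m. V (polygon w m t) z) \<longlonglongrightarrow> V (flow w t) z"
proof -
  have "(\<lambda>m. C * (L * h\<^sub>0 * (exp (C * t) + 1) * (2 / 2 ^ m))) \<longlonglongrightarrow>
      C * (L * h\<^sub>0 * (exp (C * t) + 1) * 0)"
    by (intro tendsto_intros LIMSEQ_divide_realpow_zero) simp
  then have lim: "(\<lambda>m. C * (L * h\<^sub>0 * (exp (C * t) + 1) * (2 / 2 ^ m))) \<longlonglongrightarrow> 0" by simp
  have "norm (V (polygon w m t) z - V (flow w t) z)
      \<le> C * (L * h\<^sub>0 * (exp (C * t) + 1) * (2 / 2 ^ m))" for m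
    using assms by (simp del: times_divide_eq_right times_divide_eq_left,
        intro lipschitz polygon_mem flow_mem polygon_flow_diff)
  then have "(\<lambda>m. V (polygon w m t) z - V (flow w t) z) \<longlonglongrightarrow> 0"
    by (intro Lim_null_comparison[OF always_eventually lim]) blast
  then show ?thesis by (simp add: LIM_zero_iff)
qed

lemma mesh_floor_LIMSEQ:
  assumes "0 \<le> t"
  shows "(\<lambda>m. real (nat \<lfloor>t / mesh m\<rfloor>) * mesh m) \<longlonglongrightarrow> t"
proof (rule tendsto_sandwich)
  show "(\<lambda>m. t - mesh m) \<longlonglongrightarrow> t" using tendsto_diff[OF tendsto_const mesh_LIMSEQ, of t] by simp
  have "t - mesh m \<le> real (nat \<lfloor>t / mesh m\<rfloor>) * mesh m" for m
  proof -
    have "t / mesh m - 1 \<le> real (nat \<lfloor>t / mesh m\<rfloor>)" by linarith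
    then have "(t / mesh m - 1) * mesh m \<le> real (nat \<lfloor>t / mesh m\<rfloor>) * mesh m"
      using mesh_pos[of m] by (intro mult_right_mono) auto
    then show ?thesis using mesh_pos[of m] by (simp add: algebra_simps)
  qed
  then show "\<forall>\<^sub>F m in sequentially. t - mesh m \<le> real (nat \<lfloor>t / mesh m\<rfloor>) * mesh m" by simp
  have "real (nat \<lfloor>t / mesh m\<rfloor>) * mesh m \<le> t" for m
  proof -
    have "0 \<le> t / mesh m" using assms mesh_pos[of m] by simp
    then have "real (nat \<lfloor>t / mesh m\<rfloor>) \<le> t / mesh m" by linarith
    then show ?thesis using mesh_pos[of m] by (simp add: pos_le_divide_eq)
  qed
  then show "\<forall>\<^sub>F m in sequentially. real (nat \<lfloor>t / mesh m\<rfloor>) * mesh m \<le> t" by simp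
qed simp

text \<open>\<open>euler_iterate_taylor\<close> between the grid points below \<open>s\<close> and
  below \<open>t\<close>, passed to the limit. The quadratic remainder gives differentiability
  directly, without an integral equation.\<close>

lemma flow_taylor_forward:
  assumes "w \<in> K" "0 \<le> s" "s \<le> t" "z \<in> Z"
  shows "\<bar>flow w t z - flow w s z - (t - s) * V (flow w s) z\<bar> \<le> C * L * (t - s)\<^sup>2"
proof -
  define n where "n m = nat \<lfloor>t / mesh m\<rfloor> - nat \<lfloor>s / mesh m\<rfloor>" for m
  have le: "nat \<lfloor>s / mesh m\<rfloor> \<le> nat \<lfloor>t / mesh m\<rfloor>" for m
    using assms(3) mesh_pos[of m] by (intro nat_mono floor_mono divide_right_mono) auto
  have "(\<lambda>m. real (nat \<lfloor>t / mesh m\<rfloor>) * mesh m - real (nat \<lfloor>s / mesh m\<rfloor>) * mesh m) \<longlonglongrightarrow> t - s"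
    using assms by (intro tendsto_diff mesh_floor_LIMSEQ) auto
  then have n_lim: "(\<lambda>m. real (n m) * mesh m) \<longlonglongrightarrow> t - s"
    using le by (simp add: n_def of_nat_diff left_diff_distrib)
  have "\<bar>polygon w m t z - polygon w m s z - real (n m) * mesh m * V (polygon w m s) z\<bar>
      \<le> C * L * (real (n m) * mesh m)\<^sup>2" for m
    using euler_iterate_taylor[of w "mesh m" z "nat \<lfloor>s / mesh m\<rfloor>" "n m"] le[of m] assms
      mesh_pos[of m] mesh_le[of m] by (simp add: polygon_def n_def)
  moreover have "(\<lambda>m. \<bar>polygon w m t z - polygon w m s z
      - real (n m) * mesh m * V (polygon w m s) z\<bar>)
      \<longlonglongrightarrow> \<bar>flow w t z - flow w s z - (t - s) * V (flow w s) z\<bar>"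
    using assms by (intro tendsto_intros polygon_LIMSEQ V_polygon_LIMSEQ n_lim) auto
  moreover have "(\<lambda>m. C * L * (real (n m) * mesh m)\<^sup>2) \<longlonglongrightarrow> C * L * (t - s)\<^sup>2"
    by (intro tendsto_intros n_lim)
  ultimately show ?thesis by (intro LIMSEQ_le) auto
qed

lemma flow_diff:
  assumes "w \<in> K" "0 \<le> s" "s \<le> t" "z \<in> Z"
  shows "\<bar>flow w t z - flow w s z\<bar> \<le> L * (t - s)"
proof -
  define n where "n m = nat \<lfloor>t / mesh m\<rfloor> - nat \<lfloor>s / mesh m\<rfloor>" for m
  have le: "nat \<lfloor>s / mesh m\<rfloor> \<le> nat \<lfloor>t / mesh m\<rfloor>" for m
    using assms(3) mesh_pos[of m] by (intro nat_mono floor_mono divide_right_mono) auto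
  have "(\<lambda>m. real (nat \<lfloor>t / mesh m\<rfloor>) * mesh m - real (nat \<lfloor>s / mesh m\<rfloor>) * mesh m) \<longlonglongrightarrow> t - s"
    using assms by (intro tendsto_diff mesh_floor_LIMSEQ) auto
  then have n_lim: "(\<lambda>m. real (n m) * mesh m) \<longlonglongrightarrow> t - s"
    using le by (simp add: n_def of_nat_diff left_diff_distrib)
  have "\<bar>polygon w m t z - polygon w m s z\<bar> \<le> L * (real (n m) * mesh m)" for m
    using euler_iterate_diff[of w "mesh m" z "nat \<lfloor>s / mesh m\<rfloor>" "n m"] le[of m] assms
      mesh_pos[of m] mesh_le[of m] by (simp add: polygon_def n_def)
  moreover have "(\<lambda>m. \<bar>polygon w m t z - polygon w m s z\<bar>) \<longlonglongrightarrow> \<bar>flow w t z - flow w s z\<bar>"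
    using assms by (intro tendsto_intros polygon_LIMSEQ) auto
  moreover have "(\<lambda>m. L * (real (n m) * mesh m)) \<longlonglongrightarrow> L * (t - s)"
    by (intro tendsto_intros n_lim)
  ultimately show ?thesis by (intro LIMSEQ_le) auto
qed

text \<open>Derivatives at positive times are two-sided. For t < s the forward expansion at
  \<open>t\<close> applies, and moving the argument of \<open>V\<close> from time \<open>t\<close>
  to time \<open>s\<close> costs a second term of the same size, hence the factor 2.\<close>

lemma flow_taylor:
  assumes "w \<in> K" "0 \<le> s" "0 \<le> t" "z \<in> Z"
  shows "\<bar>flow w t z - flow w s z - (t - s) * V (flow w s) z\<bar> \<le> 2 * C * L * (t - s)\<^sup>2"
proof (cases "s \<le> t")
  case True
  then show ?thesis
    using flow_taylor_forward[OF assms(1,2) True assms(4)] L_nonneg C_nonneg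
      mult_nonneg_nonneg[of "C * L" "(t - s)\<^sup>2"] by simp
next
  case False
  then have "t \<le> s" by simp
  have "\<bar>V (flow w s) z - V (flow w t) z\<bar> \<le> C * (L * (s - t))"
    using assms \<open>t \<le> s\<close> by (intro lipschitz flow_mem flow_diff)
  then have "\<bar>(s - t) * (V (flow w s) z - V (flow w t) z)\<bar> \<le> (s - t) * (C * (L * (s - t)))"
    using \<open>t \<le> s\<close> by (simp add: abs_mult mult_left_mono)
  moreover have "(s - t) * (C * (L * (s - t))) = C * L * (s - t)\<^sup>2"
    by (simp add: power2_eq_square algebra_simps)
  moreover have "\<bar>flow w s z - flow w t z - (s - t) * V (flow w t) z\<bar> \<le> C * L * (s - t)\<^sup>2"
    using assms \<open>t \<le> s\<close> by (intro flow_taylor_forward)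
  moreover have "flow w t z - flow w s z - (t - s) * V (flow w s) z =
      (s - t) * (V (flow w s) z - V (flow w t) z) - (flow w s z - flow w t z - (s
          - t) * V (flow w t) z)"
    by (simp add: algebra_simps)
  ultimately have "\<bar>flow w t z - flow w s z - (t - s) * V (flow w s) z\<bar> \<le> 2 * (C * L * (s - t)\<^sup>2)"
    by linarith
  then show ?thesis by (simp add: power2_commute mult.assoc)
qed

end

section \<open>Random graphs with independent disjoint edges\<close>

lemma finite_clique_graph [simp]: "finite (clique_graph k)"
  by (rule finite_subset[of _ "Pow {1..k}"]) (auto simp: clique_graph_def)

lemma card_clique_graph: "card (clique_graph k) = k choose 2"
  using n_subsets[of "{1..k}" 2] by (simp add: clique_graph_def)

lemma graphs_memD:
  assumes "F \<in> graphs k"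
  shows "F \<subseteq> clique_graph k" and "finite F"
  using assms finite_subset[of F "clique_graph k"] by (auto simp: graphs_def)

lemma card_split:
  assumes "finite A"
  shows "card A = card {x \<in> A. P x} + card {x \<in> A. \<not> P x}"
proof -
  have "A = {x \<in> A. P x} \<union> {x \<in> A. \<not> P x}" by blast
  then have "card A = card ({x \<in> A. P x} \<union> {x \<in> A. \<not> P x})" by simp
  also have "\<dots> = card {x \<in> A. P x} + card {x \<in> A. \<not> P x}"
    using assms by (intro card_Un_disjoint) auto
  finally show ?thesis .
qed

lemma real_choose_two: "real (n choose 2) = real n * (real n - 1) / 2"
  by (cases n) (simp_all add: choose_two field_simps real_of_nat_div)

lemma card_disjoint_edges:
  assumes "e \<in> clique_graph k"
  shows "card {f \<in> clique_graph k. e \<inter> f = {}} = (k - 2) choose 2"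
proof -
  have e: "e \<subseteq> {1..k}" "card e = 2" using assms by (auto simp: clique_graph_def)
  have "{f \<in> clique_graph k. e \<inter> f = {}} = {f. f \<subseteq> {1..k} - e \<and> card f = 2}"
    by (auto simp: clique_graph_def)
  moreover have "card ({1..k} - e) = k - 2"
    using e by (subst card_Diff_subset) (auto intro: finite_subset)
  ultimately show ?thesis using n_subsets[of "{1..k} - e" 2] by simp
qed

text \<open>The edge itself and the 2 (k - 2) edges sharing exactly one vertex with it.\<close>

lemma card_intersecting_edges:
  assumes "e \<in> clique_graph k" "2 \<le> k"
  shows "real (card {f \<in> clique_graph k. e \<inter> f \<noteq> {}}) = 2 * real k - 3"
proof -
  have "card (clique_graph k) = card {f \<in> clique_graph k. e \<inter> f = {}} + card {f
      \<in> clique_graph k. e \<inter> f \<noteq> {}}"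
    by (rule card_split) simp
  then have "real (k choose 2) = real ((k - 2) choose 2) + real (card {f
      \<in> clique_graph k. e \<inter> f \<noteq> {}})"
    by (simp add: card_clique_graph card_disjoint_edges[OF assms(1)])
  then show ?thesis using assms(2)
    by (simp add: real_choose_two of_nat_diff field_simps)
qed

text \<open>The pairs are ordered, so each unordered disjoint pair counts twice.\<close>

definition disjoint_pairs :: "graph \<Rightarrow> nat" where
  "disjoint_pairs F = (\<Sum>e\<in>F. card {f \<in> F. e \<inter> f = {}})"

text \<open>Every edge meets at most 2 k - 3 edges of \<open>F\<close>, itself included. The bound
  carries information only when \<open>F\<close> has more edges than that.\<close>

lemma disjoint_pairs_ge:
  assumes "F \<in> graphs k" "2 \<le> k"
  shows "real (card F) * (real (card F) - (2 * real k - 3)) \<le> real (disjoint_pairs F)"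
proof -
  have "real (card F) - (2 * real k - 3) \<le> real (card {f \<in> F. e \<inter> f = {}})" if "e \<in> F" for e
  proof -
    have "card F = card {f \<in> F. e \<inter> f = {}} + card {f \<in> F. e \<inter> f \<noteq> {}}"
      by (rule card_split) (rule graphs_memD(2)[OF assms(1)])
    moreover have "card {f \<in> F. e \<inter> f \<noteq> {}} \<le> card {f \<in> clique_graph k. e \<inter> f \<noteq> {}}"
      using graphs_memD[OF assms(1)] by (intro card_mono) auto
    ultimately show ?thesis
      using card_intersecting_edges[of e k] graphs_memD[OF assms(1)] that assms(2) by auto
  qed
  then have "(\<Sum>e\<in>F. real (card F) - (2 * real k - 3)) \<le> (\<Sum>e\<in>F. real (card {f \<in> F. e \<inter> f = {}}))"
    by (rule sum_mono)
  then show ?thesis by (simp add: disjoint_pairs_def)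
qed

text \<open>Pairwise intersecting edges form a star, with at most k - 1 edges, or lie in a triangle,
  with at most 3; both are fewer than k.\<close>

lemma ex_disjoint_edges:
  assumes "F \<in> graphs k" "k \<le> card F" "4 \<le> k"
  shows "\<exists>e\<in>F. \<exists>f\<in>F. e \<inter> f = {}"
proof (rule ccontr)
  assume "\<not> ?thesis"
  then have meet: "\<And>e f. e \<in> F \<Longrightarrow> f \<in> F \<Longrightarrow> e \<inter> f \<noteq> {}" by blast
  have edge: "e \<subseteq> {1..k} \<and> card e = 2" if "e \<in> F" for e
    using that graphs_memD(1)[OF assms(1)] by (auto simp: clique_graph_def)
  have "F \<noteq> {}" using assms by auto
  then obtain a b where ab: "{a, b} \<in> F" "a \<noteq> b" using edge by (metis card_2_iff ex_in_conv)
  have other: "\<exists>c. f = {v, c} \<and> c \<noteq> v \<and> c \<in> {1..k}" if "f \<in> F" "v \<in> f" for f v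
    using edge[OF that(1)] that(2) by (auto simp: card_2_iff doubleton_eq_iff)
  have no_star: "\<exists>f\<in>F. v \<notin> f" if v: "v \<in> {1..k}" for v
  proof (rule ccontr)
    assume "\<not> ?thesis"
    then have sub: "F \<subseteq> (\<lambda>c. {v, c}) ` ({1..k} - {v})" using other[of _ v] by blast
    have "card F \<le> card ((\<lambda>c. {v, c}) ` ({1..k} - {v}))" using sub by (intro card_mono) auto
    also have "\<dots> \<le> card ({1..k} - {v})" by (rule card_image_le) simp
    finally show False using v assms by simp
  qed
  have "a \<in> {1..k}" "b \<in> {1..k}" using edge[OF ab(1)] by auto
  \<comment> \<open>Since no vertex lies on all edges, \<open>f\<close> avoids \<open>a\<close> and
    hence passes through \<open>b\<close>, while \<open>g\<close> avoids \<open>b\<close> and passes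
    through \<open>a\<close>. As they meet, they share a third vertex and close a triangle with {a,
    b}.\<close>
  then obtain f g where f: "f \<in> F" "a \<notin> f" and g: "g \<in> F" "b \<notin> g" using no_star by metis
  have "b \<in> f" using meet[OF ab(1) f(1)] f by auto
  then obtain c where c: "f = {b, c}" "c \<noteq> b" "c \<noteq> a" using other[OF f(1)] f(2) by auto
  have "a \<in> g" using meet[OF ab(1) g(1)] g by auto
  then obtain d where d: "g = {a, d}" "d \<noteq> a" "d \<noteq> b" using other[OF g(1)] g(2) by auto
  have "d = c" using meet[OF f(1) g(1)] c d ab by auto
  \<comment> \<open>A pair that meets all three sides of a triangle is one of its sides.\<close>
  have "F \<subseteq> {{a, b}, {b, c}, {a, c}}"
  proof
    fix h assume h: "h \<in> F"
    from edge[OF h] obtain p q where pq: "h = {p, q}" "p \<noteq> q" by (auto simp: card_2_iff)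
    have "{a, b} \<inter> h \<noteq> {}" "{b, c} \<inter> h \<noteq> {}" "{a, c} \<inter> h \<noteq> {}"
      using meet h ab f g c d \<open>d = c\<close> by auto
    then show "h \<in> {{a, b}, {b, c}, {a, c}}" using pq ab c by (auto simp: doubleton_eq_iff)
  qed
  then have "card F \<le> card {{a, b}, {b, c}, {a, c}}" by (intro card_mono) auto
  also have "\<dots> \<le> 3" by (simp add: card_insert_if)
  finally show False using assms by simp
qed

lemma disjoint_pairs_ge_2:
  assumes "F \<in> graphs k" "k \<le> card F" "4 \<le> k"
  shows "2 \<le> disjoint_pairs F"
proof -
  obtain e f where ef: "e \<in> F" "f \<in> F" "e \<inter> f = {}" using ex_disjoint_edges[OF assms] by blast
  have "e \<noteq> {}" using ef graphs_memD(1)[OF assms(1)] by (auto simp: clique_graph_def)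
  then have "e \<noteq> f" using ef by auto
  have "1 \<le> card {h \<in> F. e \<inter> h = {}}" "1 \<le> card {h \<in> F. f \<inter> h = {}}"
    using ef graphs_memD(2)[OF assms(1)] by (auto simp: Suc_le_eq card_gt_0_iff)
  then have "2 \<le> (\<Sum>e\<in>{e, f}. card {h \<in> F. e \<inter> h = {}})" using \<open>e \<noteq> f\<close> by simp
  also have "\<dots> \<le> disjoint_pairs F"
    unfolding disjoint_pairs_def using ef graphs_memD(2)[OF assms(1)] by (intro sum_mono2) auto
  finally show ?thesis .
qed

text \<open>The distribution on graphs obtained by sampling from a graphon of density \<open>p\<close>: edges without
  a common vertex are independent, and nothing is assumed about the others.\<close>

locale random_graph =
  fixes k :: nat and w :: "graph \<Rightarrow> real" and p :: real
  assumes w_nonneg: "\<And>F. F \<in> graphs k \<Longrightarrow> 0 \<le> w F"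
    and w_sum: "(\<Sum>F\<in>graphs k. w F) = 1"
    and w_edge: "\<And>e. e \<in> clique_graph k \<Longrightarrow> (\<Sum>F\<in>graphs k. w F * of_bool (e \<in> F)) = p"
    and w_edges: "\<And>e f. e \<in> clique_graph k \<Longrightarrow> f \<in> clique_graph k \<Longrightarrow> e \<inter> f = {} \<Longrightarrow>
      (\<Sum>F\<in>graphs k. w F * of_bool (e \<in> F \<and> f \<in> F)) = p\<^sup>2"
    and k_ge: "5 \<le> k"
begin

text \<open>The non-strict inequality includes graphs with exactly half of the edges, so this bounds
  from above the probability that the extremist rule jumps to the complete graph.\<close>

definition dense :: real where
  "dense = (\<Sum>F | F \<in> graphs k \<and> k choose 2 \<le> 2 * card F. w F)"

section \<open>Moments and tail bounds for the number of edges\<close>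

lemma p_nonneg: "0 \<le> p"
proof -
  have "{1, 2} \<in> clique_graph k" using k_ge by (auto simp: clique_graph_def)
  from w_edge[OF this, symmetric] show ?thesis by (auto intro!: sum_nonneg w_nonneg)
qed

lemma card_graph_eq_sum:
  assumes "F \<in> graphs k"
  shows "real (card F) = (\<Sum>e\<in>clique_graph k. of_bool (e \<in> F))"
proof -
  have "clique_graph k \<inter> F = F" using graphs_memD(1)[OF assms] by auto
  then show ?thesis by (simp add: of_bool_def sum.If_cases)
qed

lemma mean_card: "(\<Sum>F\<in>graphs k. w F * real (card F)) = real (k choose 2) * p"
proof -
  have "(\<Sum>F\<in>graphs k. w F * real (card F)) =
      (\<Sum>F\<in>graphs k. \<Sum>e\<in>clique_graph k. w F * of_bool (e \<in> F))"
    by (intro sum.cong refl) (simp only: card_graph_eq_sum sum_distrib_left)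
  also have "\<dots> = (\<Sum>e\<in>clique_graph k. \<Sum>F\<in>graphs k. w F * of_bool (e \<in> F))"
    by (rule sum.swap)
  also have "\<dots> = (\<Sum>e\<in>clique_graph k. p)" by (intro sum.cong refl w_edge)
  finally show ?thesis by (simp add: card_clique_graph)
qed

lemma mean_disjoint_pairs:
  "(\<Sum>F\<in>graphs k. w F * real (disjoint_pairs F)) = real (k choose 2) * real ((k - 2) choose 2) * p\<^sup>2"
proof -
  let ?E = "clique_graph k"
  let ?D = "\<lambda>e. {f \<in> ?E. e \<inter> f = {}}"
  have Z: "real (disjoint_pairs F) = (\<Sum>e\<in>?E. \<Sum>f\<in>?D e. of_bool (e \<in> F \<and> f \<in> F))" if "F \<in> graphs k"
      for F
  proof -
    have F: "?E \<inter> F = F" using graphs_memD(1)[OF that] by auto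
    have "(\<Sum>f\<in>?D e. of_bool (e \<in> F \<and> f \<in> F)) =
        (if e \<in> F then real (card {f \<in> F. e \<inter> f = {}}) else 0)" for e
    proof (cases "e \<in> F")
      case True
      have "?D e \<inter> F = {f \<in> F. e \<inter> f = {}}" using F by auto
      then show ?thesis using True by (simp add: of_bool_def sum.If_cases)
    qed simp
    then have "(\<Sum>e\<in>?E. \<Sum>f\<in>?D e. of_bool (e \<in> F \<and> f \<in> F)) =
        (\<Sum>e\<in>?E. if e \<in> F then real (card {f \<in> F. e \<inter> f = {}}) else 0)" by simp
    also have "\<dots> = (\<Sum>e\<in>F. real (card {f \<in> F. e \<inter> f = {}}))"
      using F by (simp add: sum.If_cases)
    finally show ?thesis by (simp add: disjoint_pairs_def)
  qed
  have "(\<Sum>F\<in>graphs k. w F * real (disjoint_pairs F)) =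
      (\<Sum>F\<in>graphs k. \<Sum>e\<in>?E. \<Sum>f\<in>?D e. w F * of_bool (e \<in> F \<and> f \<in> F))"
    by (intro sum.cong refl) (simp only: Z sum_distrib_left)
  also have "\<dots> = (\<Sum>e\<in>?E. \<Sum>F\<in>graphs k. \<Sum>f\<in>?D e. w F * of_bool (e \<in> F \<and> f \<in> F))"
    by (rule sum.swap)
  also have "\<dots> = (\<Sum>e\<in>?E. \<Sum>f\<in>?D e. \<Sum>F\<in>graphs k. w F * of_bool (e \<in> F \<and> f \<in> F))"
    by (intro sum.cong refl sum.swap)
  also have "\<dots> = (\<Sum>e\<in>?E. \<Sum>f\<in>?D e. p\<^sup>2)"
    by (intro sum.cong refl w_edges) auto
  also have "\<dots> = (\<Sum>e\<in>?E. real ((k - 2) choose 2) * p\<^sup>2)"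
    by (intro sum.cong refl) (simp add: card_disjoint_edges)
  finally show ?thesis by (simp add: card_clique_graph)
qed

text \<open>By \<open>disjoint_pairs_ge\<close>, X^2 is at most the number of disjoint pairs plus (2
  k - 3) X; both expectations are known exactly.\<close>

lemma second_moment:
  "(\<Sum>F\<in>graphs k. w F * (real (card F))\<^sup>2)
    \<le> real (k choose 2) * real ((k - 2) choose 2) * p\<^sup>2 + real (k choose 2) * (2 * real k - 3) * p"
proof -
  have "w F * (real (card F))\<^sup>2 \<le> w F * real (disjoint_pairs F) + (2 * real k
      - 3) * (w F * real (card F))"
    if "F \<in> graphs k" for F
    using mult_left_mono[OF disjoint_pairs_ge[OF that] w_nonneg[OF that]] k_ge
    by (simp add: power2_eq_square algebra_simps)
  then have "(\<Sum>F\<in>graphs k. w F * (real (card F))\<^sup>2) \<le>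
      (\<Sum>F\<in>graphs k. w F * real (disjoint_pairs F) + (2 * real k - 3) * (w F * real (card F)))"
    by (rule sum_mono)
  also have "\<dots> = (\<Sum>F\<in>graphs k. w F * real (disjoint_pairs F)) +
      (2 * real k - 3) * (\<Sum>F\<in>graphs k. w F * real (card F))"
    by (simp add: sum.distrib sum_distrib_left)
  finally show ?thesis by (simp add: mean_card mean_disjoint_pairs algebra_simps)
qed

text \<open>Markov's inequality, used below both for squared deviations and for the number of
  disjoint pairs.\<close>

lemma markov_dense:
  assumes "\<And>F. F \<in> graphs k \<Longrightarrow> 0 \<le> g F"
    and "\<And>F. F \<in> graphs k \<Longrightarrow> k choose 2 \<le> 2 * card F \<Longrightarrow> c \<le> g F"
  shows "c * dense \<le> (\<Sum>F\<in>graphs k. w F * g F)"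
proof -
  have "c * dense = (\<Sum>F | F \<in> graphs k \<and> k choose 2 \<le> 2 * card F. w F * c)"
    by (simp add: dense_def sum_distrib_left mult.commute)
  also have "\<dots> \<le> (\<Sum>F | F \<in> graphs k \<and> k choose 2 \<le> 2 * card F. w F * g F)"
    by (intro sum_mono mult_left_mono) (auto intro: assms w_nonneg)
  also have "\<dots> \<le> (\<Sum>F\<in>graphs k. w F * g F)"
    by (intro sum_mono2) (auto intro: assms w_nonneg mult_nonneg_nonneg finite_graphs)
  finally show ?thesis .
qed

lemma dense_chebyshev:
  assumes "p < 1 / 2"
  shows "(1 / 2 - p)\<^sup>2 * dense \<le> 4 / real k * p"
proof -
  define N where "N = real (k choose 2)"
  define D where "D = real ((k - 2) choose 2)"
  have N: "N = real k * (real k - 1) / 2" by (simp add: N_def real_choose_two)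
  have "0 < N" using k_ge by (simp add: N)
  have "D \<le> N" using k_ge by (simp add: N_def D_def binomial_right_mono)
  have "(N * (1 / 2 - p))\<^sup>2 * dense \<le> (\<Sum>F\<in>graphs k. w F * (real (card F) - N * p)\<^sup>2)"
  proof (rule markov_dense)
    fix F assume "k choose 2 \<le> 2 * card F"
    then have "N * (1 / 2 - p) \<le> real (card F) - N * p" by (simp add: N_def algebra_simps)
    moreover have "0 \<le> N * (1 / 2 - p)" using assms \<open>0 < N\<close> by simp
    ultimately show "(N * (1 / 2 - p))\<^sup>2 \<le> (real (card F) - N * p)\<^sup>2" by (intro power_mono)
  qed simp
  also have "\<dots> = (\<Sum>F\<in>graphs k. w F * (real (card F))\<^sup>2 - 2 * N * p * (w F * real (card F))
      + (N * p)\<^sup>2 * w F)"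
    by (intro sum.cong refl) (simp add: power2_eq_square algebra_simps)
  also have "\<dots> = (\<Sum>F\<in>graphs k. w F * (real (card F))\<^sup>2)
      - 2 * N * p * (\<Sum>F\<in>graphs k. w F * real (card F)) + (N * p)\<^sup>2 * (\<Sum>F\<in>graphs k. w F)"
    by (simp add: sum.distrib sum_subtractf sum_distrib_left)
  also have "\<dots> \<le> N * D * p\<^sup>2 + N * (2 * real k - 3) * p - 2 * N * p * (N * p) + (N * p)\<^sup>2"
    using second_moment by (simp add: mean_card w_sum N_def D_def)
  \<comment> \<open>The quadratic terms add up to N (D - N) p^2, which is at most 0: only
    intersecting pairs contribute to the variance.\<close>
  also have "\<dots> \<le> N * (2 * real k - 3) * p"
    using mult_right_mono[OF mult_left_mono[OF \<open>D \<le> N\<close>, of N], of "p\<^sup>2"] \<open>0 < N\<close>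
    by (simp add: power2_eq_square algebra_simps)
  also have "\<dots> \<le> N\<^sup>2 * (4 / real k * p)"
  proof -
    \<comment> \<open>The right-hand side is 2 k - 2.\<close>
    have "2 * real k - 3 \<le> N * (4 / real k)" using k_ge by (simp add: N)
    then have "N * (2 * real k - 3) * p \<le> N * (N * (4 / real k)) * p"
      using p_nonneg \<open>0 < N\<close> by (intro mult_right_mono mult_left_mono) auto
    then show ?thesis by (simp add: power2_eq_square mult_ac)
  qed
  finally have "N\<^sup>2 * ((1 / 2 - p)\<^sup>2 * dense) \<le> N\<^sup>2 * (4 / real k * p)"
    by (simp add: power_mult_distrib mult.assoc)
  then show ?thesis using \<open>0 < N\<close> by (subst (asm) mult_le_cancel_left_pos) auto
qed

text \<open>For k >= 5 half of all edges amount to at least k edges, which forces one disjoint pair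
  in both orders. This serves k = 5, 6, 7, where N/2 < 2 k - 3 and \<open>disjoint_pairs_ge\<close>
  says nothing at N/2 edges.\<close>

lemma dense_le_pairs:
  "2 * dense \<le> real (k choose 2) * real ((k - 2) choose 2) * p\<^sup>2"
  unfolding mean_disjoint_pairs[symmetric]
proof (rule markov_dense)
  fix F assume F: "F \<in> graphs k" "k choose 2 \<le> 2 * card F"
  have "real k * 4 \<le> real k * (real k - 1)" using k_ge by (intro mult_left_mono) auto
  then have "2 * real k \<le> real (k choose 2)" by (simp add: real_choose_two)
  then have "k \<le> card F" using F(2) by linarith
  then show "2 \<le> real (disjoint_pairs F)" using disjoint_pairs_ge_2[OF F(1)] k_ge by simp
qed simp

text \<open>From k = 8 on, N/2 exceeds 2 k - 3, so a graph with half of the edges has of the order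
  of N^2 disjoint pairs and both coefficients are quadratic in k.\<close>

lemma dense_le_large:
  assumes "8 \<le> k"
  shows "((real k)\<^sup>2 - 9 * real k + 12) * dense \<le> 4 * (real k - 2) * (real k - 3) * p\<^sup>2"
proof -
  define N where "N = real (k choose 2)"
  have N: "N = real k * (real k - 1) / 2" by (simp add: N_def real_choose_two)
  have "0 < N" using k_ge by (simp add: N)
  have pos: "0 < N / 2 - (2 * real k - 3)"
  proof -
    have "0 \<le> real k * (real k - 8)" "0 \<le> (real k - 8) * (real k - 8)" using assms by auto
    then have "0 < real k * real k - 9 * real k + 12" using assms by (simp add: algebra_simps)
    then show ?thesis by (simp add: N field_simps)
  qed
  have "N / 2 * (N / 2 - (2 * real k - 3)) * dense \<le> (\<Sum>F\<in>graphs k. w F * real (disjoint_pairs F))"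
  proof (rule markov_dense)
    fix F assume F: "F \<in> graphs k" "k choose 2 \<le> 2 * card F"
    then have "N / 2 \<le> real (card F)" by (simp add: N_def)
    then have "N / 2 * (N / 2 - (2 * real k - 3)) \<le> real (card F) * (real (card F) - (2 * real k
        - 3))"
      using \<open>0 < N\<close> pos by (intro mult_mono) auto
    then show "N / 2 * (N / 2 - (2 * real k - 3)) \<le> real (disjoint_pairs F)"
      using disjoint_pairs_ge[OF F(1)] k_ge by linarith
  qed simp
  then have "N * ((N / 4 - (2 * real k - 3) / 2) * dense) \<le> N * (real ((k - 2) choose 2) * p\<^sup>2)"
    by (simp add: mean_disjoint_pairs N_def field_simps)
  then have "(N / 4 - (2 * real k - 3) / 2) * dense \<le> real ((k - 2) choose 2) * p\<^sup>2"
    using \<open>0 < N\<close> by simp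
  \<comment> \<open>The factor 8 clears the denominators: 2 N - 8 k + 12 = k^2 - 9 k + 12.\<close>
  then have "8 * ((N / 4 - (2 * real k - 3) / 2) * dense) \<le> 8 * (real ((k - 2) choose 2) * p\<^sup>2)"
    by simp
  then show ?thesis using k_ge
    by (simp add: N real_choose_two of_nat_diff power2_eq_square field_simps)
qed

text \<open>Any constant below 1 in place of 7/8 would yield exponential decay. Small densities are
  handled by counting pairs, those below the square-root bound by Chebyshev.\<close>

lemma dense_le:
  assumes "p \<le> threshold_bound k"
  shows "dense \<le> 7 / 8 * p"
proof -
  \<comment> \<open>A quadratic bound in p becomes a linear one as soon as p <= 7 a / (8 b).\<close>
  have quad: "dense \<le> 7 / 8 * p" if "a * dense \<le> b * p\<^sup>2" "0 < a" "b * p \<le> 7 / 8 * a" for a b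
  proof -
    have "a * dense \<le> (b * p) * p" using that(1) by (simp add: power2_eq_square mult.assoc)
    also have "\<dots> \<le> 7 / 8 * a * p" using that(3) p_nonneg by (intro mult_right_mono)
    finally have "a * dense \<le> a * (7 / 8 * p)" by (simp add: mult_ac)
    then show ?thesis using that(2) by simp
  qed
  show ?thesis
  proof (cases "k = 5")
    case True
    then show ?thesis
      \<comment> \<open>Here 30 = 10 * 3 is the number of ordered pairs of disjoint edges on 5
        vertices; for k = 6 and k = 7 below it is 15 * 6 = 90 and 21 * 10 = 210.\<close>
      using assms dense_le_pairs by (intro quad[of 2 30]) (auto simp: threshold_bound_def
          choose_two)
  next
    case False
    then have k6: "6 \<le> k" using k_ge by simp
    show ?thesis
    proof (cases "p \<le> 2 powr (- 4 - 24 / (real k - 5))")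
      case True
      have "2 powr (- 4 - 24 / (real k - 5)) \<le> 2 powr (- 4 :: real)"
        using k6 by (intro powr_mono) auto
      then have p16: "p \<le> 1 / 16" using True by (simp add: powr_minus_divide)
      consider "k = 6" | "k = 7" | "k = 8" | "9 \<le> k" using k6 by linarith
      then show ?thesis
      proof cases
        case 1
        have "p \<le> 2 powr (- 28)" using True 1 by simp
        then have "p \<le> 1 / 2 ^ 28" by (simp add: powr_minus_divide)
        then show ?thesis using dense_le_pairs 1
          by (intro quad[of 2 90]) (auto simp: choose_two)
      next
        case 2
        have "p \<le> 2 powr (- 16)" using True 2 by simp
        then have "p \<le> 1 / 2 ^ 16" by (simp add: powr_minus_divide)
        then show ?thesis using dense_le_pairs 2
          by (intro quad[of 2 210]) (auto simp: choose_two)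
      next
        case 3
        have "p \<le> 2 powr (- 12)" using True 3 by simp
        then have "p \<le> 1 / 2 ^ 12" by (simp add: powr_minus_divide)
        then show ?thesis using dense_le_large 3
          by (intro quad[of 4 120]) auto
      next
        case 4
        define x where "x = real k - 9"
        have k: "real k = x + 9" and "0 \<le> x" using 4 by (auto simp: x_def)
        have "0 \<le> x * x" by simp
        show ?thesis
        proof (rule quad[OF dense_le_large])
          show "8 \<le> k" using 4 by simp
          have "(real k)\<^sup>2 - 9 * real k + 12 = x * x + 9 * x + 12"
            unfolding k by (simp add: power2_eq_square algebra_simps)
          then show "0 < (real k)\<^sup>2 - 9 * real k + 12" using \<open>0 \<le> x\<close> \<open>0 \<le> x * x\<close> by linarith
          have "4 * (real k - 2) * (real k - 3) * p \<le> 4 * (real k - 2) * (real k - 3) * (1 / 16)"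
            using p16 4 by (intro mult_left_mono) auto
          \<comment> \<open>With x = k - 9 this is an inequality between quadratics whose constant
            terms are both 21/2. At k = 9 it is an equality, so 7/8 is the best constant that p <=
            1/16 permits in this estimate.\<close>
          also have "\<dots> \<le> 7 / 8 * ((real k)\<^sup>2 - 9 * real k + 12)"
            unfolding k using \<open>0 \<le> x\<close> \<open>0 \<le> x * x\<close> by (simp add: power2_eq_square field_simps)
          finally show "4 * (real k - 2) * (real k - 3) * p \<le> 7 / 8 * ((real k)\<^sup>2 - 9 * real k
              + 12)" .
        qed
      qed
    next
      case False
      \<comment> \<open>In this range the squared distance of p from 1/2 is at least 48/k, and
        Chebyshev gives even \<open>dense\<close> <= p/12.\<close>
      then have p: "sqrt (48 / real k) \<le> 1 / 2 - p"
        using assms \<open>k \<noteq> 5\<close> by (simp add: threshold_bound_def le_max_iff_disj)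
      have k0: "0 < 48 / real k" using k6 by simp
      have "p < 1 / 2" using p real_sqrt_gt_zero[OF k0] by linarith
      have "48 / real k \<le> (1 / 2 - p)\<^sup>2"
        using power_mono[OF p, of 2] k0 by simp
      have "0 \<le> dense" unfolding dense_def by (intro sum_nonneg) (auto intro: w_nonneg)
      then have "48 / real k * dense \<le> 4 / real k * p"
        using mult_right_mono[OF \<open>48 / real k \<le> (1 / 2 - p)\<^sup>2\<close>] dense_chebyshev[OF \<open>p < 1 / 2\<close>]
            by fastforce
      then have "48 * dense \<le> 4 * p" using k6 by (simp add: field_simps)
      then show ?thesis using p_nonneg by simp
    qed
  qed
qed

end

section \<open>Velocity on graphons\<close>

context prob_space
begin

abbreviation prod2 :: "('a \<times> 'a) measure" where
  "prod2 \<equiv> M \<Otimes>\<^sub>M M"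

abbreviation prodI :: "nat set \<Rightarrow> (nat \<Rightarrow> 'a) measure" where
  "prodI I \<equiv> Pi\<^sub>M I (\<lambda>_. M)"

lemma prob_space_prod2: "prob_space prod2"
proof -
  interpret pair_prob_space M M by unfold_locales
  show ?thesis by (rule P.prob_space_axioms)
qed

lemma prob_space_prodI: "prob_space (prodI I)"
  by (intro prob_space_PiM prob_space_axioms)

lemma measurable_two_points:
  assumes "a \<in> I" "b \<in> I"
  shows "(\<lambda>x. (snd x)(a := fst (fst x), b := snd (fst x))) \<in> prod2 \<Otimes>\<^sub>M prodI (I
      - {a, b}) \<rightarrow>\<^sub>M prodI I"
proof (intro measurable_fun_upd)
  show "I = insert a (I - {a, b}) \<union> {b}" using assms by auto
  show "insert a (I - {a, b}) = (I - {a, b}) \<union> {a}" by auto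
qed measurable

text \<open>Inserting two further independent coordinates gives the full product; this is checked on
  boxes, which determine a finite product measure.\<close>

lemma prodI_eq_distr:
  assumes I: "finite I" "a \<in> I" "b \<in> I" "a \<noteq> b"
  shows "prodI I = distr (prod2 \<Otimes>\<^sub>M prodI (I - {a, b})) (prodI I)
    (\<lambda>x. (snd x)(a := fst (fst x), b := snd (fst x)))" (is "_ = distr ?P _ ?T")
proof -
  interpret product_sigma_finite "\<lambda>_. M" by unfold_locales
  interpret J: prob_space "prodI (I - {a, b})" by (rule prob_space_prodI)
  interpret PP: prob_space prod2 by (rule prob_space_prod2)
  note T = measurable_two_points[OF I(2,3)]
  have "distr ?P (prodI I) ?T = prodI I"
  proof (rule PiM_eqI[OF I(1)])
    fix A :: "nat \<Rightarrow> 'a set" assume A: "\<And>i. i \<in> I \<Longrightarrow> A i \<in> sets M"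
    have sub: "A i \<subseteq> space M" if "i \<in> I" for i using A[OF that] by (rule sets.sets_into_space)
    have "?T -` (Pi\<^sub>E I A) \<inter> space ?P = (A a \<times> A b) \<times> Pi\<^sub>E (I - {a, b}) A"
    proof (intro set_eqI iffI)
      fix x assume x: "x \<in> ?T -` (Pi\<^sub>E I A) \<inter> space ?P"
      obtain u v \<xi> where [simp]: "x = ((u, v), \<xi>)" by (metis surj_pair)
      have T: "\<xi>(a := u, b := v) \<in> Pi\<^sub>E I A" and \<xi>: "\<xi> \<in> extensional (I - {a, b})"
        using x by (auto simp: space_pair_measure space_PiM PiE_def)
      have "u \<in> A a" "v \<in> A b" using PiE_mem[OF T I(2)] PiE_mem[OF T I(3)] I(4) by auto
      moreover have "\<xi> i \<in> A i" if "i \<in> I - {a, b}" for i using PiE_mem[OF T, of i] that by auto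
      ultimately show "x \<in> (A a \<times> A b) \<times> Pi\<^sub>E (I - {a, b}) A" using \<xi> by (auto simp: PiE_def)
    next
      fix x assume x: "x \<in> (A a \<times> A b) \<times> Pi\<^sub>E (I - {a, b}) A"
      obtain u v \<xi> where [simp]: "x = ((u, v), \<xi>)" by (metis surj_pair)
      have uv: "u \<in> A a" "v \<in> A b" "\<xi> \<in> Pi\<^sub>E (I - {a, b}) A" using x by auto
      then have "\<xi>(a := u, b := v) \<in> Pi\<^sub>E I A" using I by (auto simp: PiE_def extensional_def)
      moreover have "x \<in> space ?P"
        using uv sub[of a] sub[of b] sub I by (auto simp: space_pair_measure space_PiM PiE_def
            Pi_def)
      ultimately show "x \<in> ?T -` (Pi\<^sub>E I A) \<inter> space ?P" by simp
    qed
    then have "emeasure (distr ?P (prodI I) ?T) (Pi\<^sub>E I A) = emeasure ?P ((A a \<times> A b) \<times> Pi\<^sub>E (I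
        - {a, b}) A)"
      using I A by (subst emeasure_distr[OF T]) (auto intro!: sets_PiM_I_finite)
    also have "\<dots> = emeasure M (A a) * emeasure M (A b) * (\<Prod>i\<in>I - {a, b}. emeasure M (A i))"
    proof -
      have "emeasure (prodI (I - {a, b})) (Pi\<^sub>E (I - {a, b}) A) = (\<Prod>i\<in>I - {a, b}. emeasure M (A i))"
        using I A by (intro emeasure_PiM) auto
      then show ?thesis using I A
        by (subst J.emeasure_pair_measure_Times)
          (auto intro!: sets_PiM_I_finite simp: emeasure_pair_measure_Times)
    qed
    also have "\<dots> = (\<Prod>i\<in>insert a (insert b (I - {a, b})). emeasure M (A i))"
      using I by (simp add: mult.assoc)
    also have "insert a (insert b (I - {a, b})) = I" using I by auto
    finally show "emeasure (distr ?P (prodI I) ?T) (Pi\<^sub>E I A) = (\<Prod>i\<in>I. emeasure M (A i))" .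
  qed simp
  then show ?thesis by simp
qed

text \<open>Fubini in the shape of \<open>rooted_ind_density\<close>: the root pair is the outer
  variable, the remaining vertices the inner one.\<close>

lemma integral_two_points:
  fixes h :: "(nat \<Rightarrow> 'a) \<Rightarrow> real"
  assumes I: "finite I" "a \<in> I" "b \<in> I" "a \<noteq> b"
    and h: "h \<in> borel_measurable (prodI I)" "\<And>\<xi>. \<xi> \<in> space (prodI I) \<Longrightarrow> \<bar>h \<xi>\<bar> \<le> B"
  shows "(LINT \<xi>|prodI I. h \<xi>) =
    (LINT z|prod2. LINT \<xi>|prodI (I - {a, b}). h (\<xi>(a := fst z, b := snd z)))"
proof -
  let ?T = "\<lambda>x. (snd x)(a := fst (fst x), b := snd (fst x))"
  note T = measurable_two_points[OF I(2,3)]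
  interpret J: prob_space "prodI (I - {a, b})" by (rule prob_space_prodI)
  interpret PP: prob_space prod2 by (rule prob_space_prod2)
  interpret Q: pair_prob_space prod2 "prodI (I - {a, b})" by unfold_locales
  have "(LINT \<xi>|prodI I. h \<xi>) = (LINT x|(prod2 \<Otimes>\<^sub>M prodI (I - {a, b})). h (?T x))"
    by (subst prodI_eq_distr[OF I], rule integral_distr[OF T h(1)])
  also have "\<dots> = (LINT z|prod2. LINT \<xi>|prodI (I - {a, b}). h (?T (z, \<xi>)))"
  proof (rule Q.integral_fst'[symmetric], rule Q.P.integrable_const_bound)
    show "AE x in prod2 \<Otimes>\<^sub>M prodI (I - {a, b}). norm (h (?T x)) \<le> B"
      using measurable_space[OF T] h(2) by (auto intro!: AE_I2)
    show "(\<lambda>x. h (?T x)) \<in> borel_measurable (prod2 \<Otimes>\<^sub>M prodI (I - {a, b}))"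
      by (rule measurable_compose[OF T h(1)])
  qed
  finally show ?thesis by simp
qed

end

section \<open>Induced weights, rooted densities and bounds on the velocity\<close>

definition edge_value :: "('a \<times> 'a \<Rightarrow> real) \<Rightarrow> (nat \<Rightarrow> 'a) \<Rightarrow> nat set \<Rightarrow> real" where
  "edge_value W \<xi> e = W (\<xi> (Min e), \<xi> (Max e))"

lemma clique_graphE:
  assumes "e \<in> clique_graph k"
  obtains i j where "e = {i, j}" "i < j" "i \<in> {1..k}" "j \<in> {1..k}" "Min e = i" "Max e = j"
proof -
  obtain x y where e: "e = {x, y}" "x \<noteq> y" "x \<in> {1..k}" "y \<in> {1..k}"
    using assms by (auto simp: clique_graph_def card_2_iff)
  show ?thesis
  proof (cases "x < y")
    case True then show ?thesis using e by (intro that[of x y]) auto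
  next
    case False then show ?thesis using e by (intro that[of y x]) auto
  qed
qed

text \<open>\<open>Min\<close> and \<open>Max\<close> recover the orientation i < j from the edge.
  Indexing by edges allows a single factor to be removed and the product of sums to be expanded over
  subsets.\<close>

lemma ind_weight_eq:
  "ind_weight k F W \<xi> =
    (\<Prod>e\<in>clique_graph k. if e \<in> F then edge_value W \<xi> e else 1 - edge_value W \<xi> e)"
  unfolding ind_weight_def
  by (rule prod.reindex_bij_witness[of _ "\<lambda>e. (Min e, Max e)" "\<lambda>(i, j). {i, j}"])
    (auto simp: edge_value_def clique_graph_def card_2_iff elim!: clique_graphE[unfolded
        clique_graph_def])

text \<open>Given the positions of the vertices, the edges are independent; summing over the edges
  outside \<open>D\<close> leaves factors x + (1 - x) = 1. This is an algebraic identity, without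
  any bound on \<open>W\<close>.\<close>

lemma sum_ind_weight:
  assumes "D \<subseteq> clique_graph k"
  shows "(\<Sum>F\<in>graphs k. ind_weight k F W \<xi> * of_bool (D \<subseteq> F)) = (\<Prod>e\<in>D. edge_value W \<xi> e)"
proof -
  let ?E = "clique_graph k" and ?x = "edge_value W \<xi>"
  have "ind_weight k F W \<xi> * of_bool (D \<subseteq> F) =
      (\<Prod>e\<in>F. ?x e) * (\<Prod>e\<in>?E - F. if e \<in> D then 0 else 1 - ?x e)" if "F \<in> graphs k" for F
  proof -
    have F: "F \<subseteq> ?E" using graphs_memD(1)[OF that] .
    have "ind_weight k F W \<xi> = (\<Prod>e\<in>?E - F. 1 - ?x e) * (\<Prod>e\<in>F. ?x e)"
      unfolding ind_weight_eq by (subst prod.subset_diff[OF F]) auto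
    \<comment> \<open>The condition on \<open>F\<close> is absorbed into the product: a missing edge
      of \<open>D\<close> contributes the factor 0.\<close>
    moreover have "(\<Prod>e\<in>?E - F. if e \<in> D then 0 else 1 - ?x e) =
        (\<Prod>e\<in>?E - F. 1 - ?x e) * of_bool (D \<subseteq> F)"
    proof (cases "D \<subseteq> F")
      case True
      then show ?thesis by (auto intro!: prod.cong)
    next
      case False
      then obtain e where "e \<in> D" "e \<notin> F" by blast
      then have "\<exists>e\<in>?E - F. (if e \<in> D then 0 else 1 - ?x e) = 0" using assms by auto
      then show ?thesis using False by (simp only: prod_zero finite_Diff finite_clique_graph) simp
    qed
    ultimately show ?thesis by simp
  qed
  then have "(\<Sum>F\<in>graphs k. ind_weight k F W \<xi> * of_bool (D \<subseteq> F)) =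
      (\<Sum>F\<in>Pow ?E. (\<Prod>e\<in>F. ?x e) * (\<Prod>e\<in>?E - F. if e \<in> D then 0 else 1 - ?x e))"
    by (simp add: graphs_def)
  also have "\<dots> = (\<Prod>e\<in>?E. ?x e + (if e \<in> D then 0 else 1 - ?x e))"
    by (rule prod_add[symmetric]) simp
  also have "\<dots> = (\<Prod>e\<in>?E. if e \<in> D then ?x e else 1)" by (intro prod.cong) auto
  also have "\<dots> = (\<Prod>e\<in>D. ?x e)"
    using assms by (simp add: prod.If_cases Int_absorb1)
  finally show ?thesis .
qed

text \<open>The number of terms of the fourfold sum in \<open>velocity\<close>, a crude uniform
  bound for it on graphons.\<close>

definition velocity_const :: "nat \<Rightarrow> real" where
  "velocity_const k = (\<Sum>F\<in>graphs k. \<Sum>H\<in>graphs k. \<Sum>a\<in>{1..k}. \<Sum>b\<in>{1..k} - {a}. 1)"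

lemma velocity_const_nonneg: "0 \<le> velocity_const k"
  unfolding velocity_const_def by (intro sum_nonneg) auto

context prob_space
begin

lemma graphonD:
  assumes "graphon M W"
  shows "W \<in> borel_measurable prod2"
    and "z \<in> space prod2 \<Longrightarrow> 0 \<le> W z" and "z \<in> space prod2 \<Longrightarrow> W z \<le> 1"
    and "x \<in> space M \<Longrightarrow> y \<in> space M \<Longrightarrow> W (x, y) = W (y, x)"
  using assms by (auto simp: graphon_def kernel_def)

lemma edge_value_mem:
  assumes "graphon M W" "\<xi> \<in> space (prodI I)" "e \<in> clique_graph k" "e \<subseteq> I"
  shows "0 \<le> edge_value W \<xi> e" "edge_value W \<xi> e \<le> 1"
    "(\<xi> (Min e), \<xi> (Max e)) \<in> space prod2"
proof -
  obtain i j where e: "e = {i, j}" "Min e = i" "Max e = j" using assms(3) by (rule clique_graphE)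
  then have "i \<in> I" "j \<in> I" using assms(4) by auto
  then show "(\<xi> (Min e), \<xi> (Max e)) \<in> space prod2"
    using assms(2) unfolding e(2,3) by (auto simp: space_pair_measure space_PiM)
  then show "0 \<le> edge_value W \<xi> e" "edge_value W \<xi> e \<le> 1"
    unfolding edge_value_def by (auto intro: graphonD[OF assms(1)])
qed

lemma edge_value_mem_all:
  assumes "graphon M W" "\<xi> \<in> space (prodI {1..k})" "e \<in> clique_graph k"
  shows "0 \<le> edge_value W \<xi> e" "edge_value W \<xi> e \<le> 1"
    "(\<xi> (Min e), \<xi> (Max e)) \<in> space prod2"
  using edge_value_mem[OF assms] assms(3) by (auto simp: clique_graph_def)

lemma edge_value_measurable:
  assumes "graphon M W" "e \<in> clique_graph k" "e \<subseteq> I"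
  shows "(\<lambda>\<xi>. edge_value W \<xi> e) \<in> borel_measurable (prodI I)"
proof -
  obtain i j where e: "e = {i, j}" "Min e = i" "Max e = j" using assms(2) by (rule clique_graphE)
  then have "i \<in> I" "j \<in> I" using assms(3) by auto
  then have "(\<lambda>\<xi>. (\<xi> i, \<xi> j)) \<in> prodI I \<rightarrow>\<^sub>M prod2" by measurable
  from measurable_compose[OF this graphonD(1)[OF assms(1)]] show ?thesis
      by (simp add: edge_value_def e(2,3))
qed

lemma ind_weight_measurable:
  assumes "graphon M W"
  shows "ind_weight k F W \<in> borel_measurable (prodI {1..k})"
proof -
  have "(\<lambda>\<xi>. if e \<in> F then edge_value W \<xi> e else 1 - edge_value W \<xi> e)
      \<in> borel_measurable (prodI {1..k})"
    if "e \<in> clique_graph k" for e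
  proof -
    have "e \<subseteq> {1..k}" using that by (auto simp: clique_graph_def)
    from edge_value_measurable[OF assms that this] show ?thesis
      by (cases "e \<in> F") (simp_all del: One_nat_def)
  qed
  then show ?thesis unfolding ind_weight_eq[abs_def] by (intro borel_measurable_prod) auto
qed

lemma ind_weight_mem:
  assumes "graphon M W" "\<xi> \<in> space (prodI {1..k})"
  shows "0 \<le> ind_weight k F W \<xi>" "ind_weight k F W \<xi> \<le> 1"
  unfolding ind_weight_eq using edge_value_mem_all[OF assms]
  by (auto intro!: prod_nonneg prod_le_1 simp: if_distrib)

text \<open>All other factors lie in [0, 1]. Applied to the root pair, this keeps the factor that
  makes the graphons invariant.\<close>

lemma ind_weight_le_edge:
  assumes "graphon M W" "\<xi> \<in> space (prodI {1..k})" "e \<in> clique_graph k"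
  shows "ind_weight k F W \<xi> \<le> (if e \<in> F then edge_value W \<xi> e else 1 - edge_value W \<xi> e)"
proof -
  let ?g = "\<lambda>e. if e \<in> F then edge_value W \<xi> e else 1 - edge_value W \<xi> e"
  have "ind_weight k F W \<xi> = ?g e * (\<Prod>f\<in>clique_graph k - {e}. ?g f)"
    unfolding ind_weight_eq using assms(3) by (simp add: prod.remove)
  also have "\<dots> \<le> ?g e * 1"
    using edge_value_mem_all[OF assms(1,2)] assms(3) by (intro mult_left_mono prod_le_1) auto
  finally show ?thesis by simp
qed

text \<open>Replacing one factor at a time in products with factors in [0, 1]; there are
  \<open>k choose 2\<close> factors.\<close>

lemma ind_weight_lipschitz:
  assumes "graphon M U" "graphon M W" "\<And>z. z \<in> space prod2 \<Longrightarrow> \<bar>U z - W z\<bar> \<le> d"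
    and "\<xi> \<in> space (prodI {1..k})"
  shows "\<bar>ind_weight k F U \<xi> - ind_weight k F W \<xi>\<bar> \<le> real (k choose 2) * d"
proof -
  let ?g = "\<lambda>W e. if e \<in> F then edge_value W \<xi> e else 1 - edge_value W \<xi> e"
  have "norm ((\<Prod>e\<in>clique_graph k. ?g U e) - (\<Prod>e\<in>clique_graph k. ?g W e))
      \<le> (\<Sum>e\<in>clique_graph k. norm (?g U e - ?g W e))"
    using edge_value_mem_all[OF assms(1,4)] edge_value_mem_all[OF assms(2,4)]
    by (intro norm_prod_diff) auto
  also have "\<dots> \<le> (\<Sum>e\<in>clique_graph k. d)"
  proof (rule sum_mono)
    fix e assume "e \<in> clique_graph k"
    from assms(3)[OF edge_value_mem_all(3)[OF assms(1,4) this]]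
    show "norm (?g U e - ?g W e) \<le> d" by (simp add: edge_value_def abs_minus_commute)
  qed
  finally show ?thesis by (simp add: ind_weight_eq card_clique_graph)
qed

lemma two_points_mem:
  assumes "a \<in> I" "b \<in> I" "z \<in> space prod2" "\<xi> \<in> space (prodI (I - {a, b}))"
  shows "\<xi>(a := fst z, b := snd z) \<in> space (prodI I)"
  using measurable_space[OF measurable_two_points[OF assms(1,2)], of "(z, \<xi>)"] assms(3,4)
  by (simp add: space_pair_measure)

lemma ind_weight_rooted_measurable:
  assumes "graphon M W" "a \<in> {1..k}" "b \<in> {1..k}"
  shows "(\<lambda>x. ind_weight k F W ((snd x)(a := fst (fst x), b := snd (fst x))))
    \<in> borel_measurable (prod2 \<Otimes>\<^sub>M prodI ({1..k} - {a, b}))"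
  by (rule measurable_compose[OF measurable_two_points[OF assms(2,3)] ind_weight_measurable[OF
      assms(1)]])

lemma rooted_eq: "rooted_ind_density M k F a b W z =
    (LINT \<xi>|prodI ({1..k} - {a, b}). ind_weight k F W (\<xi>(a := fst z, b := snd z)))"
  by (cases z) (simp add: rooted_ind_density_def)

lemma rooted_measurable:
  assumes "graphon M W" "a \<in> {1..k}" "b \<in> {1..k}"
  shows "rooted_ind_density M k F a b W \<in> borel_measurable prod2"
proof -
  interpret J: prob_space "prodI ({1..k} - {a, b})" by (rule prob_space_prodI)
  show ?thesis unfolding rooted_eq[abs_def]
    using ind_weight_rooted_measurable[OF assms]
    by (intro J.borel_measurable_lebesgue_integral) (simp add: case_prod_beta')
qed

lemma rooted_integrable:
  assumes "graphon M W" "a \<in> {1..k}" "b \<in> {1..k}" "z \<in> space prod2"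
  shows "integrable (prodI ({1..k} - {a, b})) (\<lambda>\<xi>. ind_weight k F W (\<xi>(a := fst z, b := snd z)))"
proof -
  interpret J: prob_space "prodI ({1..k} - {a, b})" by (rule prob_space_prodI)
  show ?thesis
  proof (rule J.integrable_const_bound[of _ 1])
    show "AE \<xi> in prodI ({1..k} - {a, b}). norm (ind_weight k F W (\<xi>(a := fst z, b := snd z))) \<le> 1"
      using ind_weight_mem[OF assms(1) two_points_mem[OF assms(2-4)]] by (intro AE_I2) auto
    show "(\<lambda>\<xi>. ind_weight k F W (\<xi>(a := fst z, b := snd z))) \<in> borel_measurable (prodI ({1..k}
        - {a, b}))"
      using measurable_Pair2[OF ind_weight_rooted_measurable[OF assms(1-3)] assms(4)] by simp
  qed
qed

lemma edge_value_rooted: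
  assumes "graphon M W" "a \<in> {1..k}" "b \<in> {1..k}" "a \<noteq> b" "z \<in> space prod2"
  shows "edge_value W (\<xi>(a := fst z, b := snd z)) {a, b} = W z"
proof (cases "a < b")
  case True
  then show ?thesis by (simp add: edge_value_def)
next
  case False
  then show ?thesis using assms(4,5) graphonD(4)[OF assms(1), of "fst z" "snd z"]
    by (auto simp: edge_value_def space_pair_measure)
qed

text \<open>The factor of the root pair depends on the roots alone and can be read off at z; the
  others integrate to at most 1.\<close>

lemma rooted_bounds:
  assumes "graphon M W" "a \<in> {1..k}" "b \<in> {1..k}" "a \<noteq> b" "z \<in> space prod2"
  shows "0 \<le> rooted_ind_density M k F a b W z"
    and "rooted_ind_density M k F a b W z \<le> (if {a, b} \<in> F then W z else 1 - W z)"
proof -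
  interpret J: prob_space "prodI ({1..k} - {a, b})" by (rule prob_space_prodI)
  note mem = two_points_mem[OF assms(2,3,5)]
  show "0 \<le> rooted_ind_density M k F a b W z"
    unfolding rooted_eq using ind_weight_mem(1)[OF assms(1) mem]
        by (intro integral_nonneg_AE AE_I2) auto
  have "{a, b} \<in> clique_graph k" using assms by (auto simp: clique_graph_def)
  then have "ind_weight k F W (\<xi>(a := fst z, b := snd z)) \<le> (if {a, b} \<in> F then W z else 1 - W z)"
    if "\<xi> \<in> space (prodI ({1..k} - {a, b}))" for \<xi>
    using ind_weight_le_edge[OF assms(1) mem[OF that], of
        "{a, b}" F] edge_value_rooted[OF assms, of \<xi>]
    by (simp split: if_splits)
  then show "rooted_ind_density M k F a b W z \<le> (if {a, b} \<in> F then W z else 1 - W z)"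
    unfolding rooted_eq by (intro J.integral_le_const rooted_integrable assms AE_I2)
qed

lemma rooted_lipschitz:
  assumes "graphon M U" "graphon M W" "\<And>z. z \<in> space prod2 \<Longrightarrow> \<bar>U z - W z\<bar> \<le> d"
    and "a \<in> {1..k}" "b \<in> {1..k}" "z \<in> space prod2"
  shows "\<bar>rooted_ind_density M k F a b U z - rooted_ind_density M k F a b W z\<bar>
      \<le> real (k choose 2) * d"
proof -
  interpret J: prob_space "prodI ({1..k} - {a, b})" by (rule prob_space_prodI)
  let ?g = "\<lambda>W \<xi>. ind_weight k F W (\<xi>(a := fst z, b := snd z))"
  note int = rooted_integrable[OF assms(1,4-6)] rooted_integrable[OF assms(2,4-6)]
  have lip: "\<bar>?g U \<xi> - ?g W \<xi>\<bar> \<le> real (k choose 2) * d" if "\<xi> \<in> space (prodI ({1..k} - {a, b}))"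
      for \<xi>
    using two_points_mem[OF assms(4-6) that] by (intro ind_weight_lipschitz assms)
  have "\<bar>LINT \<xi>|prodI ({1..k} - {a, b}). ?g U \<xi> - ?g W \<xi>\<bar>
      \<le> (LINT \<xi>|prodI ({1..k} - {a, b}). \<bar>?g U \<xi> - ?g W \<xi>\<bar>)"
    by (rule integral_abs_bound)
  also have "\<dots> \<le> real (k choose 2) * d"
    using lip int by (intro J.integral_le_const integrable_abs Bochner_Integration.integrable_diff
        AE_I2)
  finally show ?thesis using int by (simp add: rooted_eq)
qed

text \<open>A term is positive only if the root pair is absent from \<open>F\<close>, which brings a
  factor at most 1 - W z; it is negative only if the pair is present, which brings a factor at most
  W z.\<close>

lemma velocity_bounds:
  assumes "is_rule k R" "graphon M W" "z \<in> space prod2"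
  shows "- (velocity_const k * W z) \<le> velocity M k R W z"
    and "velocity M k R W z \<le> velocity_const k * (1 - W z)"
proof -
  have W: "0 \<le> W z" "W z \<le> 1" using graphonD(2,3)[OF assms(2,3)] by auto
  have summand: "- W z \<le> R F H * rooted_ind_density M k F a b W z * (of_bool ({a, b} \<in> H - F)
      - of_bool ({a, b} \<in> F - H))
      \<and> R F H * rooted_ind_density M k F a b W z * (of_bool ({a, b} \<in> H - F) - of_bool ({a, b} \<in> F
          - H)) \<le> 1 - W z"
    if "F \<in> graphs k" "H \<in> graphs k" "a \<in> {1..k}" "b \<in> {1..k} - {a}" for F H a b
  proof -
    have R: "0 \<le> R F H" "R F H \<le> 1" using assms(1) that by (auto simp: is_rule_def)
    have r: "0 \<le> rooted_ind_density M k F a b W z"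
      "rooted_ind_density M k F a b W z \<le> (if {a, b} \<in> F then W z else 1 - W z)"
      using rooted_bounds[OF assms(2) _ _ _ assms(3)] that by auto
    have "R F H * rooted_ind_density M k F a b W z \<le> rooted_ind_density M k F a b W z"
      using R r(1) by (simp add: mult_left_le_one_le)
    moreover have "0 \<le> R F H * rooted_ind_density M k F a b W z" using R r by simp
    ultimately show ?thesis using r W by (cases "{a, b} \<in> F"; cases "{a, b} \<in> H") auto
  qed
  have "- (velocity_const k * W z) = (\<Sum>F\<in>graphs k. \<Sum>H\<in>graphs k. \<Sum>a\<in>{1..k}. \<Sum>b\<in>{1..k} - {a}. - W z)"
    unfolding velocity_const_def by (simp add: sum_distrib_right)
  also have "\<dots> \<le> velocity M k R W z"
    unfolding velocity_def by (intro sum_mono) (use summand in blast)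
  finally show "- (velocity_const k * W z) \<le> velocity M k R W z" .
  have "velocity M k R W z \<le> (\<Sum>F\<in>graphs k. \<Sum>H\<in>graphs k. \<Sum>a\<in>{1..k}. \<Sum>b\<in>{1..k} - {a}. 1 - W z)"
    unfolding velocity_def by (intro sum_mono) (use summand in blast)
  also have "\<dots> = velocity_const k * (1 - W z)"
    unfolding velocity_const_def by (simp add: sum_distrib_right)
  finally show "velocity M k R W z \<le> velocity_const k * (1 - W z)" .
qed

lemma velocity_abs_le:
  assumes "is_rule k R" "graphon M W" "z \<in> space prod2"
  shows "\<bar>velocity M k R W z\<bar> \<le> velocity_const k"
proof -
  have "velocity_const k * W z \<le> velocity_const k * 1" "velocity_const k * (1 - W z)
      \<le> velocity_const k * 1"
    using graphonD(2,3)[OF assms(2,3)] velocity_const_nonneg[of k]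
        by (auto intro!: mult_left_mono simp del: mult_1_right mult.right_neutral)
  then show ?thesis using velocity_bounds[OF assms] by (simp add: abs_le_iff)
qed

lemma velocity_lipschitz:
  assumes "is_rule k R" "graphon M U" "graphon M W"
    and "\<And>z. z \<in> space prod2 \<Longrightarrow> \<bar>U z - W z\<bar> \<le> d" "z \<in> space prod2"
  shows "\<bar>velocity M k R U z - velocity M k R W z\<bar> \<le> velocity_const k * real (k choose 2) * d"
proof -
  let ?D = "\<lambda>F a b. rooted_ind_density M k F a b U z - rooted_ind_density M k F a b W z"
  have eq: "velocity M k R U z - velocity M k R W z
      = (\<Sum>F\<in>graphs k. \<Sum>H\<in>graphs k. \<Sum>a\<in>{1..k}. \<Sum>b\<in>{1..k} - {a}.
      R F H * ?D F a b * (of_bool ({a, b} \<in> H - F) - of_bool ({a, b} \<in> F - H)))"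
    unfolding velocity_def sum_subtractf[symmetric]
        by (intro sum.cong refl) (simp add: algebra_simps)
  have "\<bar>R F H * ?D F a b * (of_bool ({a, b} \<in> H - F) - of_bool ({a, b} \<in> F - H))\<bar>
      \<le> real (k choose 2) * d"
    if "F \<in> graphs k" "H \<in> graphs k" "a \<in> {1..k}" "b \<in> {1..k} - {a}" for F H a b
  proof -
    have R: "0 \<le> R F H" "R F H \<le> 1" using assms(1) that by (auto simp: is_rule_def)
    have "\<bar>R F H * ?D F a b * (of_bool ({a, b} \<in> H - F) - of_bool ({a, b} \<in> F - H))\<bar>
        \<le> \<bar>R F H * ?D F a b\<bar>"
      by (auto simp: of_bool_def)
    also have "\<dots> \<le> \<bar>?D F a b\<bar>" using R by (simp add: abs_mult mult_left_le_one_le)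
    also have "\<dots> \<le> real (k choose 2) * d"
      using that assms(5) by (intro rooted_lipschitz[OF assms(2-4)]) auto
    finally show ?thesis .
  qed
  then have "\<bar>velocity M k R U z - velocity M k R W z\<bar> \<le>
      (\<Sum>F\<in>graphs k. \<Sum>H\<in>graphs k. \<Sum>a\<in>{1..k}. \<Sum>b\<in>{1..k} - {a}. real (k choose 2) * d)"
    unfolding eq by (intro order_trans[OF sum_abs] sum_mono)
  also have "\<dots> = velocity_const k * real (k choose 2) * d"
    unfolding velocity_const_def mult.assoc by (simp add: sum_distrib_right)
  finally show ?thesis .
qed

lemma velocity_measurable:
  assumes "graphon M W"
  shows "velocity M k R W \<in> borel_measurable prod2"
  unfolding velocity_def[abs_def]
  by (intro borel_measurable_sum borel_measurable_times borel_measurable_const rooted_measurable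
      assms) auto

text \<open>Exchanging x and y amounts to exchanging the roots a and b, and the sum runs over both
  orders.\<close>

lemma velocity_symmetric: "velocity M k R W (x, y) = velocity M k R W (y, x)"
proof -
  have rooted: "rooted_ind_density M k F a b W (x, y) = rooted_ind_density M k F b a W (y, x)" if
      "a \<noteq> b" for F a b
    using that by (simp add: rooted_ind_density_def fun_upd_twist[OF that] insert_commute[of a b])
  have swap: "(\<Sum>a\<in>{1..k}. \<Sum>b\<in>{1..k} - {a}. g a b) = (\<Sum>a\<in>{1..k}. \<Sum>b\<in>{1..k} - {a}. g b a)"
    for g :: "nat \<Rightarrow> nat \<Rightarrow> real"
    by (simp add: sum.Sigma) (rule sum.reindex_bij_witness[of _ "\<lambda>(a, b). (b, a)"
        "\<lambda>(a, b). (b, a)"]; auto)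
  show ?thesis unfolding velocity_def
  proof (rule sum.cong[OF refl], rule sum.cong[OF refl])
    fix F H
    let ?g = "\<lambda>z a b. R F H * rooted_ind_density M k F a b W z *
      (of_bool ({a, b} \<in> H - F) - of_bool ({a, b} \<in> F - H))"
    have "(\<Sum>a\<in>{1..k}. \<Sum>b\<in>{1..k} - {a}. ?g (x, y) a b) = (\<Sum>a\<in>{1..k}. \<Sum>b\<in>{1..k} - {a}. ?g (x, y) b a)"
      by (rule swap)
    also have "\<dots> = (\<Sum>a\<in>{1..k}. \<Sum>b\<in>{1..k} - {a}. ?g (y, x) a b)"
    proof (intro sum.cong[OF refl])
      fix a b assume "b \<in> {1..k} - {a}"
      then show "?g (x, y) b a = ?g (y, x) a b" using rooted[of b a F] by (simp add: insert_commute)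
    qed
    finally show "(\<Sum>a\<in>{1..k}. \<Sum>b\<in>{1..k} - {a}. ?g (x, y) a b) =
      (\<Sum>a\<in>{1..k}. \<Sum>b\<in>{1..k} - {a}. ?g (y, x) a b)" .
  qed
qed

text \<open>With Q = \<open>velocity_const k\<close> and h Q <= 1, the new value lies between (1 - h
  Q) W >= 0 and W + h Q (1 - W) <= 1. The summand 1 in the denominator avoids a division by zero
  when Q = 0.\<close>

lemma graphon_step:
  assumes "is_rule k R" "graphon M W" "0 \<le> h" "h \<le> 1 / (velocity_const k + 1)"
  shows "graphon M (\<lambda>z. W z + h * velocity M k R W z)"
proof -
  note [measurable] = graphonD(1)[OF assms(2)] velocity_measurable[OF assms(2), of k R]
  have hQ: "h * velocity_const k \<le> 1"
    using assms(3,4) velocity_const_nonneg[of k] by (simp add: field_simps)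
  have range: "0 \<le> W z + h * velocity M k R W z \<and> W z + h * velocity M k R W z \<le> 1" if z: "z
      \<in> space prod2" for z
  proof -
    have W: "0 \<le> W z" "W z \<le> 1" using graphonD(2,3)[OF assms(2) z] by auto
    have "h * - (velocity_const k * W z) \<le> h * velocity M k R W z"
      "h * velocity M k R W z \<le> h * (velocity_const k * (1 - W z))"
      using mult_left_mono[OF velocity_bounds(1)[OF assms(1,2) z] assms(3)]
        mult_left_mono[OF velocity_bounds(2)[OF assms(1,2) z] assms(3)] .
    moreover have "h * velocity_const k * W z \<le> 1 * W z" "h * velocity_const k * (1 - W z)
        \<le> 1 * (1 - W z)"
      using mult_right_mono[OF hQ, of "W z"] mult_right_mono[OF hQ, of "1 - W z"] W by simp_all
    ultimately show ?thesis by (simp add: mult.assoc)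
  qed
  moreover have "(\<lambda>z. W z + h * velocity M k R W z) \<in> borel_measurable prod2" by measurable
  ultimately show ?thesis
    using graphonD(4)[OF assms(2)] velocity_symmetric[of k R W]
    by (auto simp: graphon_def kernel_def abs_le_iff intro!: exI[of _ 1])
qed

lemma graphon_LIMSEQ:
  assumes "\<And>n. graphon M (F n)" "\<And>z. z \<in> space prod2 \<Longrightarrow> (\<lambda>n. F n z) \<longlonglongrightarrow> f z"
  shows "graphon M f"
proof -
  have range: "0 \<le> f z \<and> f z \<le> 1" if "z \<in> space prod2" for z
    using LIMSEQ_le_const[OF assms(2)[OF that]] LIMSEQ_le_const2[OF assms(2)[OF that]]
      graphonD(2,3)[OF assms(1) that] by blast
  moreover have "f \<in> borel_measurable prod2"
    using assms graphonD(1) by (intro borel_measurable_LIMSEQ_real[of prod2 F f]) auto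
  moreover have "f (x, y) = f (y, x)" if "x \<in> space M" "y \<in> space M" for x y
  proof (rule LIMSEQ_unique)
    show "(\<lambda>n. F n (x, y)) \<longlonglongrightarrow> f (x, y)" using assms(2) that by (auto simp: space_pair_measure)
    show "(\<lambda>n. F n (x, y)) \<longlonglongrightarrow> f (y, x)"
      using assms(2)[of "(y, x)"] graphonD(4)[OF assms(1) that] that
          by (simp add: space_pair_measure)
  qed
  ultimately show ?thesis by (fastforce simp: graphon_def kernel_def intro!: exI[of _ 1])
qed

lemma invariant_vector_field_velocity:
  assumes "is_rule k R"
  shows "invariant_vector_field (velocity M k R) {W. graphon M W} (space prod2)
    (1 / (velocity_const k + 1)) (velocity_const k) (velocity_const k * real (k choose 2))"
proof
  show "0 < 1 / (velocity_const k + 1)" using velocity_const_nonneg[of k] by simp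
  show "f \<in> {W. graphon M W}"
    if "\<And>n::nat. F n \<in> {W. graphon M W}" "\<And>z. z \<in> space prod2 \<Longrightarrow> (\<lambda>n. F n z) \<longlonglongrightarrow> f z" for F f
    using that graphon_LIMSEQ[of F f] by blast
qed (use velocity_const_nonneg[of k] in
  \<open>auto intro: graphon_step[OF assms] velocity_abs_le[OF assms] velocity_lipschitz[OF assms]\<close>)

end

section \<open>Decay of the density\<close>

lemma sum_ordered_pairs:
  assumes "G \<subseteq> clique_graph k"
  shows "(\<Sum>a\<in>{1..k}. \<Sum>b\<in>{1..k} - {a}. of_bool ({a, b} \<in> G)) = 2 * real (card G)"
proof -
  let ?S = "SIGMA a:{1..k}. {1..k} - {a}"
  have fin: "finite G" using assms by (rule finite_subset) simp
  have edge: "(\<Sum>x\<in>?S. of_bool ({fst x, snd x} = e)) = (2::real)" if "e \<in> G" for e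
  proof -
    have "e \<in> clique_graph k" using that assms by blast
    then obtain i j where e: "e = {i, j}" "i < j" "i \<in> {1..k}" "j \<in> {1..k}"
      by (rule clique_graphE)
    have "?S \<inter> {x. {fst x, snd x} = e} = {(i, j), (j, i)}" using e by (auto simp: doubleton_eq_iff)
    then show ?thesis using e(2) by (simp add: of_bool_def sum.If_cases)
  qed
  have "(\<Sum>a\<in>{1..k}. \<Sum>b\<in>{1..k} - {a}. of_bool ({a, b} \<in> G)) =
      (\<Sum>x\<in>?S. of_bool ({fst x, snd x} \<in> G) :: real)"
    by (subst sum.Sigma) (simp_all add: case_prod_beta')
  also have "\<dots> = (\<Sum>x\<in>?S. \<Sum>e\<in>G. of_bool ({fst x, snd x} = e))"
    using fin by (intro sum.cong refl) (simp add: of_bool_def)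
  also have "\<dots> = (\<Sum>e\<in>G. \<Sum>x\<in>?S. of_bool ({fst x, snd x} = e))" by (rule sum.swap)
  also have "\<dots> = (\<Sum>e\<in>G. 2)" by (intro sum.cong refl edge)
  finally show ?thesis by simp
qed

lemma sum_ordered_pairs_diff:
  assumes "F \<in> graphs k" "H \<in> graphs k"
  shows "(\<Sum>a\<in>{1..k}. \<Sum>b\<in>{1..k} - {a}. of_bool ({a, b} \<in> H - F) - of_bool ({a, b} \<in> F - H))
    = 2 * (real (card H) - real (card F))"
proof -
  have "(\<Sum>a\<in>{1..k}. \<Sum>b\<in>{1..k} - {a}. of_bool ({a, b} \<in> H - F) - of_bool ({a, b} \<in> F - H) :: real) =
      (\<Sum>a\<in>{1..k}. \<Sum>b\<in>{1..k} - {a}. of_bool ({a, b} \<in> H)) - (\<Sum>a\<in>{1..k}. \<Sum>b\<in>{1..k}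
          - {a}. of_bool ({a, b} \<in> F))"
    unfolding sum_subtractf[symmetric] by (intro sum.cong refl) auto
  then show ?thesis
    using sum_ordered_pairs[OF graphs_memD(1)[OF assms(1)]] sum_ordered_pairs[OF graphs_memD(1)[OF
        assms(2)]]
    by simp
qed

text \<open>Equality holds away from the balanced case. A graph with exactly half of the edges is
  kept, while the right-hand side is N/2 >= 0.\<close>

lemma sum_extremist_rule_le:
  assumes "F \<in> graphs k"
  shows "(\<Sum>H\<in>graphs k. extremist_rule k F H * (real (card H) - real (card F)))
    \<le> real (k choose 2) * of_bool (k choose 2 \<le> 2 * card F) - real (card F)"
proof -
  have pick: "(\<Sum>H\<in>graphs k. of_bool (H = G) * g H) = g G" if "G \<in> graphs k" for G and g ::
      "graph \<Rightarrow> real"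
    using that finite_graphs[of k] by (simp add: of_bool_def if_distrib[of
        "\<lambda>x. x * _"] sum.delta cong: if_cong)
  have mem: "{} \<in> graphs k" "clique_graph k \<in> graphs k" by (auto simp: graphs_def)
  consider "real (card F) < 1 / 2 * real (k choose 2)" | "real (card F) > 1 / 2 * real (k choose 2)"
    | "real (card F) = 1 / 2 * real (k choose 2)" by linarith
  then show ?thesis
    by cases (auto simp: extremist_rule_def pick mem assms card_clique_graph)
qed

section \<open>Samples from a graphon and the derivative of its density\<close>

context prob_space
begin

text \<open>The unrooted induced density of \<open>F\<close> in \<open>W\<close>.\<close>

definition sample_weight :: "nat \<Rightarrow> ('a \<times> 'a \<Rightarrow> real) \<Rightarrow> graph \<Rightarrow> real" where
  "sample_weight k W F = (LINT \<xi>|prodI {1..k}. ind_weight k F W \<xi>)"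

lemma integrable_ind_weight:
  assumes "graphon M W"
  shows "integrable (prodI {1..k}) (ind_weight k F W)"
proof -
  interpret J: prob_space "prodI {1..k}" by (rule prob_space_prodI)
  show ?thesis
    using ind_weight_mem[OF assms] by (intro J.integrable_const_bound[of _ 1]
        ind_weight_measurable assms AE_I2) auto
qed

lemma integrable_graphon: "graphon M W \<Longrightarrow> integrable prod2 W"
  using graphonD[of W]
  by (intro finite_measure.integrable_const_bound[OF prob_space.finite_measure[OF
      prob_space_prod2], of _ 1] AE_I2) auto

lemma integral_edge_value:
  assumes "graphon M W" "e \<in> clique_graph k" "e \<subseteq> I" "finite I"
  shows "(LINT \<xi>|prodI I. edge_value W \<xi> e) = (LINT z|prod2. W z)"
proof -
  obtain i j where e: "e = {i, j}" "i < j" "Min e = i" "Max e = j" using assms(2)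
      by (rule clique_graphE)
  interpret J: prob_space "prodI (I - {i, j})" by (rule prob_space_prodI)
  have "(LINT \<xi>|prodI I. edge_value W \<xi> e) =
      (LINT z|prod2. LINT \<xi>|prodI (I - {i, j}). edge_value W (\<xi>(i := fst z, j := snd z)) e)"
    using edge_value_mem(1,2)[OF assms(1) _ assms(2,3)] e assms
    by (intro integral_two_points[where B = 1] edge_value_measurable) auto
  also have "\<dots> = (LINT z|prod2. W z)"
    using e(2) by (simp add: edge_value_def e(3,4) J.prob_space)
  finally show ?thesis .
qed

lemma integral_edge_value_mult:
  assumes "graphon M W" "e \<in> clique_graph k" "f \<in> clique_graph k" "e \<inter> f = {}"
  shows "(LINT \<xi>|prodI {1..k}. edge_value W \<xi> e * edge_value W \<xi> f) = (LINT z|prod2. W z)\<^sup>2"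
proof -
  obtain i j where e: "e = {i, j}" "i < j" "i \<in> {1..k}" "j \<in> {1..k}" "Min e = i" "Max e = j"
    using assms(2) by (rule clique_graphE)
  obtain c d where f: "f = {c, d}" "Min f = c" "Max f = d" using assms(3) by (rule clique_graphE)
  have ne: "c \<noteq> i" "c \<noteq> j" "d \<noteq> i" "d \<noteq> j" using assms(4) e(1) f(1) by auto
  have sub: "e \<subseteq> {1..k}" "f \<subseteq> {1..k}" "f \<subseteq> {1..k} - {i, j}"
    using assms(2-4) e(1) by (auto simp: clique_graph_def)
  have "(LINT \<xi>|prodI {1..k}. edge_value W \<xi> e * edge_value W \<xi> f) =
      (LINT z|prod2. LINT \<xi>|prodI ({1..k} - {i, j}).
        edge_value W (\<xi>(i := fst z, j := snd z)) e * edge_value W (\<xi>(i := fst z, j := snd z)) f)"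
  proof (rule integral_two_points[where B = 1])
    show "(\<lambda>\<xi>. edge_value W \<xi> e * edge_value W \<xi> f) \<in> borel_measurable (prodI {1..k})"
      using assms sub by (intro borel_measurable_times edge_value_measurable)
    fix \<xi> assume "\<xi> \<in> space (prodI {1..k})"
    from edge_value_mem_all(1,2)[OF assms(1) this] assms(2,3)
    show "\<bar>edge_value W \<xi> e * edge_value W \<xi> f\<bar> \<le> 1" by (simp add: abs_mult mult_le_one)
  qed (use e in auto)
  \<comment> \<open>The edge \<open>f\<close> avoids i and j, so its factor ignores the two updated
    coordinates and the integral splits.\<close>
  also have "\<dots> = (LINT z|prod2. W z * (LINT \<xi>|prodI ({1..k} - {i, j}). edge_value W \<xi> f))"
    using e(2) ne by (simp add: edge_value_def e(5,6) f(2,3))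
  also have "\<dots> = (LINT z|prod2. W z)\<^sup>2"
    using sub assms by (simp add: integral_edge_value power2_eq_square)
  finally show ?thesis .
qed

lemma sum_sample_weight:
  assumes "graphon M W" "D \<subseteq> clique_graph k"
  shows "(\<Sum>F\<in>graphs k. sample_weight k W F * of_bool (D \<subseteq> F)) =
    (LINT \<xi>|prodI {1..k}. (\<Prod>e\<in>D. edge_value W \<xi> e))"
proof -
  have "(\<Sum>F\<in>graphs k. sample_weight k W F * of_bool (D \<subseteq> F)) =
      (LINT \<xi>|prodI {1..k}. (\<Sum>F\<in>graphs k. ind_weight k F W \<xi> * of_bool (D \<subseteq> F)))"
    using integrable_ind_weight[OF assms(1), of k]
    by (subst Bochner_Integration.integral_sum) (auto simp: sample_weight_def simp del: One_nat_def)
  then show ?thesis by (simp only: sum_ind_weight[OF assms(2)])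
qed

text \<open>The moments are \<open>sum_sample_weight\<close> for \<open>D\<close> = {}, {e} and {e,
  f}.\<close>

lemma random_graph_sample:
  assumes "graphon M W" "5 \<le> k"
  shows "random_graph k (sample_weight k W) (LINT z|prod2. W z)"
proof
  interpret J: prob_space "prodI {1..k}" by (rule prob_space_prodI)
  show "0 \<le> sample_weight k W F" for F
    unfolding sample_weight_def using ind_weight_mem(1)[OF assms(1)]
        by (intro integral_nonneg_AE AE_I2) auto
  show "(\<Sum>F\<in>graphs k. sample_weight k W F) = 1"
    using sum_sample_weight[OF assms(1), of "{}" k] by (simp add: J.prob_space[simplified])
  show "(\<Sum>F\<in>graphs k. sample_weight k W F * of_bool (e \<in> F)) = (LINT z|prod2. W z)"
    if "e \<in> clique_graph k" for e
    using sum_sample_weight[OF assms(1), of "{e}" k] integral_edge_value[OF assms(1) that, of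
        "{1..k}"] that
    by (simp add: clique_graph_def)
  show "(\<Sum>F\<in>graphs k. sample_weight k W F * of_bool (e \<in> F \<and> f \<in> F)) = (LINT z|prod2. W z)\<^sup>2"
    if "e \<in> clique_graph k" "f \<in> clique_graph k" "e \<inter> f = {}" for e f
  proof -
    have "e \<noteq> f" using that by (auto simp: clique_graph_def)
    then show ?thesis
      using sum_sample_weight[OF assms(1), of "{e, f}" k] integral_edge_value_mult[OF assms(1)
          that] that
      by simp
  qed
qed (rule assms)

lemma integral_rooted:
  assumes "graphon M W" "a \<in> {1..k}" "b \<in> {1..k}" "a \<noteq> b"
  shows "(LINT z|prod2. rooted_ind_density M k F a b W z) = sample_weight k W F"
  unfolding rooted_eq sample_weight_def using ind_weight_mem[OF assms(1)] assms
  by (intro integral_two_points[symmetric, where B = 1] ind_weight_measurable) auto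

lemma integrable_rooted:
  assumes "graphon M W" "a \<in> {1..k}" "b \<in> {1..k}" "a \<noteq> b"
  shows "integrable prod2 (rooted_ind_density M k F a b W)"
proof (rule finite_measure.integrable_const_bound[OF prob_space.finite_measure[OF
    prob_space_prod2], of _ 1])
  show "AE z in prod2. norm (rooted_ind_density M k F a b W z) \<le> 1"
  proof (rule AE_I2)
    fix z assume "z \<in> space prod2"
    from rooted_bounds[OF assms this, of F] graphonD(2,3)[OF assms(1) this]
    show "norm (rooted_ind_density M k F a b W z) \<le> 1" by (auto split: if_splits)
  qed
qed (intro rooted_measurable assms)

text \<open>The integrated rooted density does not depend on the roots, so only the signs are summed
  over a and b. Both orders of a pair occur, whence the factor 2.\<close>

lemma integral_velocity:
  assumes "graphon M W"
  shows "(LINT z|prod2. velocity M k R W z) =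
    2 * (\<Sum>F\<in>graphs k. sample_weight k W F * (\<Sum>H\<in>graphs k. R F H * (real (card H) - real (card F))))"
proof -
  let ?s = "\<lambda>F H a b. of_bool ({a, b} \<in> H - F) - of_bool ({a, b} \<in> F - H) :: real"
  let ?t = "\<lambda>F H a b z. R F H * rooted_ind_density M k F a b W z * ?s F H a b"
  have int: "integrable prod2 (?t F H a b)" if "a \<in> {1..k}" "b \<in> {1..k} - {a}" for F H a b
    using that by (intro integrable_mult_left integrable_mult_right integrable_rooted assms) auto
  have "has_bochner_integral prod2 (velocity M k R W)
      (\<Sum>F\<in>graphs k. \<Sum>H\<in>graphs k. \<Sum>a\<in>{1..k}. \<Sum>b\<in>{1..k} - {a}. LINT z|prod2. ?t F H a b z)"
    unfolding velocity_def[abs_def]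
    by (intro has_bochner_integral_sum has_bochner_integral_integrable int)
  then have "(LINT z|prod2. velocity M k R W z) =
      (\<Sum>F\<in>graphs k. \<Sum>H\<in>graphs k. \<Sum>a\<in>{1..k}. \<Sum>b\<in>{1..k} - {a}. LINT z|prod2. ?t F H a b z)"
    by (rule has_bochner_integral_integral_eq)
  also have "\<dots> = (\<Sum>F\<in>graphs k. \<Sum>H\<in>graphs k. \<Sum>a\<in>{1..k}. \<Sum>b\<in>{1..k} - {a}.
      R F H * sample_weight k W F * ?s F H a b)"
    using integral_rooted[OF assms] by (intro sum.cong refl) (auto simp del: One_nat_def)
  also have "\<dots> = (\<Sum>F\<in>graphs k. \<Sum>H\<in>graphs k.
      R F H * sample_weight k W F * (\<Sum>a\<in>{1..k}. \<Sum>b\<in>{1..k} - {a}. ?s F H a b))"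
    by (simp only: sum_distrib_left)
  also have "\<dots> = (\<Sum>F\<in>graphs k. \<Sum>H\<in>graphs k.
      R F H * sample_weight k W F * (2 * (real (card H) - real (card F))))"
    by (intro sum.cong refl) (simp only: sum_ordered_pairs_diff)
  finally show ?thesis unfolding sum_distrib_left by (simp only: mult_ac)
qed

text \<open>The rate comes from 2 N (7/8 p - p) = - N p / 4.\<close>

lemma integral_velocity_extremist_le:
  assumes "graphon M W" "5 \<le> k" "(LINT z|prod2. W z) \<le> threshold_bound k"
  shows "(LINT z|prod2. velocity M k (extremist_rule k) W z)
    \<le> - (real (k choose 2) / 4) * (LINT z|prod2. W z)"
proof -
  interpret random_graph k "sample_weight k W" "LINT z|prod2. W z"
    by (rule random_graph_sample[OF assms(1,2)])
  let ?N = "real (k choose 2)"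
  have "(LINT z|prod2. velocity M k (extremist_rule k) W z) \<le>
      2 * (\<Sum>F\<in>graphs k. sample_weight k W F * (?N * of_bool (k choose 2 \<le> 2 * card F)
          - real (card F)))"
    unfolding integral_velocity[OF assms(1)]
    by (intro mult_left_mono sum_mono sum_extremist_rule_le w_nonneg) auto
  also have "\<dots> = 2 * (?N * (\<Sum>F\<in>graphs k. sample_weight k W F * of_bool (k choose 2 \<le> 2 * card F))
      - (\<Sum>F\<in>graphs k. sample_weight k W F * real (card F)))"
    by (simp add: right_diff_distrib sum_subtractf sum_distrib_left mult_ac)
  also have "(\<Sum>F\<in>graphs k. sample_weight k W F * of_bool (k choose 2 \<le> 2 * card F)) = dense"
    unfolding dense_def by (simp add: of_bool_def if_distrib[of
        "\<lambda>x. _ * x"] sum.inter_filter finite_graphs cong: if_cong)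
  also have "2 * (?N * dense - (\<Sum>F\<in>graphs k. sample_weight k W F * real (card F)))
      \<le> 2 * (?N * (7 / 8 * (LINT z|prod2. W z)) - ?N * (LINT z|prod2. W z))"
    unfolding mean_card using dense_le[OF assms(3)] by (intro mult_left_mono diff_right_mono) auto
  finally show ?thesis by (simp add: mult.commute)
qed

lemma integral_euler_step:
  assumes "graphon M W" "is_rule k R"
  shows "(LINT z|prod2. W z + h * velocity M k R W z) =
    (LINT z|prod2. W z) + h * (LINT z|prod2. velocity M k R W z)"
proof -
  have "integrable prod2 (velocity M k R W)"
    using velocity_abs_le[OF assms(2,1)]
    by (intro finite_measure.integrable_const_bound[OF prob_space.finite_measure[OF
        prob_space_prod2]]
        velocity_measurable assms AE_I2) auto
  then show ?thesis using integrable_graphon[OF assms(1)] by simp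
qed

lemma mass_nonneg: "graphon M W \<Longrightarrow> 0 \<le> (LINT z|prod2. W z)"
  using graphonD(2) by (intro integral_nonneg_AE AE_I2) auto

lemma euler_iterate_mass_le:
  assumes W: "graphon M W" "(LINT z|prod2. W z) \<le> threshold_bound k" and "5 \<le> k"
    and h: "0 \<le> h" "h \<le> 1 / (velocity_const k + 1)"
  shows "(LINT z|prod2. euler_iterate (velocity M k (extremist_rule k)) h W j z)
    \<le> (LINT z|prod2. W z) * exp (- (real (k choose 2) / 4) * (real j * h))"
proof (induction j)
  case (Suc j)
  interpret invariant_vector_field "velocity M k (extremist_rule k)" "{W. graphon M W}"
      "space prod2"
    "1 / (velocity_const k + 1)" "velocity_const k" "velocity_const k * real (k choose 2)"
    by (rule invariant_vector_field_velocity[OF is_rule_extremist])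
  let ?c = "real (k choose 2) / 4" and ?e = "euler_iterate (velocity M k (extremist_rule k)) h W"
  have gr: "graphon M (?e j)" using euler_iterate_mem[of W h j] W h by simp
  \<comment> \<open>The density has not grown so far, so the threshold hypothesis is still available
    for the next step.\<close>
  have "(LINT z|prod2. W z) * exp (- ?c * (real j * h)) \<le> (LINT z|prod2. W z) * 1"
    using h mass_nonneg[OF W(1)] by (intro mult_left_mono) auto
  then have le: "(LINT z|prod2. ?e j z) \<le> threshold_bound k" using Suc W(2) by simp
  have "(LINT z|prod2. ?e (Suc j) z) =
      (LINT z|prod2. ?e j z) + h * (LINT z|prod2. velocity M k (extremist_rule k) (?e j) z)"
    using integral_euler_step[OF gr is_rule_extremist] by simp
  also have "\<dots> \<le> (LINT z|prod2. ?e j z) + h * (- ?c * (LINT z|prod2. ?e j z))"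
    using integral_velocity_extremist_le[OF gr assms(3) le] h(1)
        by (intro add_left_mono mult_left_mono)
  also have "\<dots> = (1 + (- ?c * h)) * (LINT z|prod2. ?e j z)" by (simp add: algebra_simps)
  also have "\<dots> \<le> exp (- ?c * h) * (LINT z|prod2. ?e j z)"
    by (intro mult_right_mono exp_ge_add_one_self mass_nonneg gr)
  also have "\<dots> \<le> exp (- ?c * h) * ((LINT z|prod2. W z) * exp (- ?c * (real j * h)))"
    by (intro mult_left_mono Suc.IH) simp
  also have "\<dots> = (LINT z|prod2. W z) * (exp (- ?c * h) * exp (- ?c * (real j * h)))" by simp
  also have "exp (- ?c * h) * exp (- ?c * (real j * h)) = exp (- ?c * (real (Suc j) * h))"
    unfolding exp_add[symmetric] by (simp add: algebra_simps)
  finally show ?case .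
qed simp

section \<open>Convergence of the trajectory to the zero graphon\<close>

lemma cut_distance_zero_bounds:
  assumes "graphon M W"
  shows "0 \<le> cut_distance M W (\<lambda>_. 0)" "cut_distance M W (\<lambda>_. 0) \<le> (LINT z|prod2. W z)"
proof -
  let ?f = "\<lambda>(S, T). \<bar>LINT z:(S \<times> T)|prod2. (W z - 0)\<bar>"
  have le: "?f x \<le> (LINT z|prod2. W z)" if "x \<in> sets M \<times> sets M" for x
  proof -
    obtain S T where x: "x = (S, T)" "S \<times> T \<in> sets prod2" using \<open>x \<in> sets M \<times> sets M\<close> by auto
    have int: "integrable prod2 (\<lambda>z. indicator (S \<times> T) z *\<^sub>R W z)"
      using integrable_mult_indicator[OF x(2) integrable_graphon[OF assms]] .
    have "\<bar>LINT z|prod2. indicator (S \<times> T) z *\<^sub>R W z\<bar>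
        \<le> (LINT z|prod2. \<bar>indicator (S \<times> T) z *\<^sub>R W z\<bar>)"
      by (rule integral_abs_bound)
    \<comment> \<open>As W is nonnegative, restriction to a rectangle cannot increase the
      integral.\<close>
    also have "\<dots> \<le> (LINT z|prod2. W z)"
      using int integrable_graphon[OF assms] graphonD(2)[OF assms]
      by (intro integral_mono integrable_abs) (auto simp: indicator_def)
    finally show ?thesis by (simp add: x(1) set_lebesgue_integral_def)
  qed
  show "cut_distance M W (\<lambda>_. 0) \<le> (LINT z|prod2. W z)"
    unfolding cut_distance_def using le by (intro cSUP_least) auto
  have "?f ({}, {}) \<le> cut_distance M W (\<lambda>_. 0)"
    unfolding cut_distance_def using le by (intro cSUP_upper bdd_aboveI2[of _ _
        "LINT z|prod2. W z"]) auto
  then show "0 \<le> cut_distance M W (\<lambda>_. 0)" by (simp add: set_lebesgue_integral_def)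
qed

lemma norm_infty_nonneg: "0 \<le> norm_infty M U"
proof -
  interpret PP: prob_space prod2 by (rule prob_space_prod2)
  have "AE z in prod2. 0 \<le> norm_infty M U"
    using esssup_AE[where M = prod2 and f = "\<lambda>z. ereal \<bar>U z\<bar>"] unfolding norm_infty_def[symmetric]
    by eventually_elim (metis abs_ge_zero ereal_less_eq(5) order_trans)
  then show ?thesis by simp
qed

lemma has_dest_zero:
  assumes W: "graphon M W" "norm_one M W \<le> threshold_bound k" and k: "5 \<le> k"
  shows "has_dest M k (extremist_rule k) W (\<lambda>_. 0)"
proof -
  let ?V = "velocity M k (extremist_rule k)"
  interpret invariant_vector_field ?V "{W. graphon M W}" "space prod2"
    "1 / (velocity_const k + 1)" "velocity_const k" "velocity_const k * real (k choose 2)"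
    by (rule invariant_vector_field_velocity[OF is_rule_extremist])
  have gr: "graphon M (flow W t)" if "0 \<le> t" for t using flow_mem[of W t] W that by simp
  have p: "(LINT z|prod2. W z) \<le> threshold_bound k"
  proof -
    have "norm_one M W = (LINT z|prod2. W z)"
      unfolding norm_one_def using graphonD(2)[OF W(1)]
          by (intro Bochner_Integration.integral_cong) auto
    then show ?thesis using W(2) by simp
  qed
  define B where "B = 2 * (velocity_const k * real (k choose 2)) * velocity_const k"
  have traj: "is_trajectory M k (extremist_rule k) W (flow W)"
    unfolding is_trajectory_def
  proof (intro conjI allI impI)
    show "kernel M (flow W t)" if "0 \<le> t" for t using gr[OF that] by (simp add: graphon_def)
    show "AE z in prod2. flow W 0 z = W z" by (simp add: flow_0)
    fix t :: real assume t: "0 \<le> t"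
    let ?n = "\<lambda>s. norm_infty M (\<lambda>z. (flow W s z - flow W t z) / (s - t) - ?V (flow W t) z)"
    \<comment> \<open>\<open>flow_taylor\<close> divided by the length of the time step. At s = t
      the quotient has a zero denominator, but the punctured filter never sees that point.\<close>
    have le: "?n s \<le> ereal (B * \<bar>s - t\<bar>)" if s: "0 \<le> s" "s \<noteq> t" for s
      unfolding norm_infty_def
    proof (rule esssup_I)
      note [measurable] = graphonD(1)[OF gr[OF t]] graphonD(1)[OF gr[OF s(1)]]
        velocity_measurable[OF gr[OF t], of k "extremist_rule k"]
      show "(\<lambda>z. ereal \<bar>(flow W s z - flow W t z) / (s - t) - ?V (flow W t) z\<bar>)
          \<in> borel_measurable prod2"
        by measurable
      show "AE z in prod2. ereal \<bar>(flow W s z - flow W t z) / (s - t) - ?V (flow W t) z\<bar>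
          \<le> ereal (B * \<bar>s - t\<bar>)"
      proof (rule AE_I2)
        fix z assume z: "z \<in> space prod2"
        let ?r = "flow W s z - flow W t z - (s - t) * ?V (flow W t) z"
        have "\<bar>?r\<bar> \<le> B * (s - t)\<^sup>2"
          using flow_taylor[of W t s z] W(1) t s z by (simp add: B_def mult_ac)
        then have "\<bar>?r\<bar> / \<bar>s - t\<bar> \<le> B * (s - t)\<^sup>2 / \<bar>s - t\<bar>" by (intro divide_right_mono) auto
        also have "B * (s - t)\<^sup>2 / \<bar>s - t\<bar> = B * \<bar>s - t\<bar>"
          using s(2) by (subst power2_abs[symmetric]) (simp add: power2_eq_square del:
              abs_mult_self_eq)
        also have "\<bar>?r\<bar> / \<bar>s - t\<bar> = \<bar>(flow W s z - flow W t z) / (s - t) - ?V (flow W t) z\<bar>"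
          using s(2) by (simp add: abs_divide[symmetric] diff_divide_distrib)
        finally show "ereal \<bar>(flow W s z - flow W t z) / (s - t) - ?V (flow W t) z\<bar>
            \<le> ereal (B * \<bar>s - t\<bar>)" by simp
      qed
    qed
    show "(?n \<longlongrightarrow> 0) (at t within {0..})"
    proof (rule tendsto_sandwich)
      show "\<forall>\<^sub>F s in at t within {0..}. 0 \<le> ?n s" by (simp add: norm_infty_nonneg)
      show "\<forall>\<^sub>F s in at t within {0..}. ?n s \<le> ereal (B * \<bar>s - t\<bar>)"
        unfolding eventually_at_filter using le by (intro always_eventually) auto
      have "((\<lambda>s. B * \<bar>s - t\<bar>) \<longlongrightarrow> B * \<bar>t - t\<bar>) (at t within {0..})" by (intro tendsto_intros)
      then have "((\<lambda>s. ereal (B * \<bar>s - t\<bar>)) \<longlongrightarrow> ereal (B * \<bar>t - t\<bar>)) (at t within {0..})"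
        by (rule tendsto_ereal)
      then show "((\<lambda>s. ereal (B * \<bar>s - t\<bar>)) \<longlongrightarrow> 0) (at t within {0..})" by (simp add: zero_ereal_def)
    qed simp
  qed
  define c where "c = real (k choose 2) / 4"
  have "0 < c" using k by (simp add: c_def)
  have decay: "(LINT z|prod2. flow W t z) \<le> (LINT z|prod2. W z) * exp (- c * t)" if t: "0 \<le> t" for t
  \<comment> \<open>The decay is known for the Euler iterates at grid times; dominated convergence,
    with bound 1, carries it over to the flow.\<close>
  proof (rule LIMSEQ_le)
    interpret PP: prob_space prod2 by (rule prob_space_prod2)
    have pgr: "graphon M (polygon W m t)" for m using polygon_mem[of W m t] W(1) by simp
    show "(\<lambda>m. LINT z|prod2. polygon W m t z) \<longlonglongrightarrow> (LINT z|prod2. flow W t z)"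
    proof (rule integral_dominated_convergence[where w = "\<lambda>_. 1"])
      show "AE z in prod2. (\<lambda>m. polygon W m t z) \<longlonglongrightarrow> flow W t z"
        using polygon_LIMSEQ[of W t] W(1) t by (intro AE_I2) auto
      show "AE z in prod2. norm (polygon W m t z) \<le> 1" for m
        using graphonD(2,3)[OF pgr] by (intro AE_I2) auto
    qed (use graphonD(1)[OF pgr] graphonD(1)[OF gr[OF t]] in auto)
    show "(\<lambda>m. (LINT z|prod2. W z) * exp (- c * (real (nat \<lfloor>t / mesh m\<rfloor>) * mesh m)))
        \<longlonglongrightarrow> (LINT z|prod2. W z) * exp (- c * t)"
      by (intro tendsto_intros mesh_floor_LIMSEQ t)
    have "(LINT z|prod2. polygon W m t z) \<le>
        (LINT z|prod2. W z) * exp (- c * (real (nat \<lfloor>t / mesh m\<rfloor>) * mesh m))" for m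
      unfolding polygon_def c_def
      using mesh_pos[of m] mesh_le[of m] by (intro euler_iterate_mass_le W p k) auto
    then show "\<exists>N. \<forall>m\<ge>N. (LINT z|prod2. polygon W m t z) \<le>
        (LINT z|prod2. W z) * exp (- c * (real (nat \<lfloor>t / mesh m\<rfloor>) * mesh m))" by blast
  qed
  have "((\<lambda>t. cut_distance M (flow W t) (\<lambda>_. 0)) \<longlongrightarrow> 0) at_top"
  proof (rule tendsto_sandwich)
    show "\<forall>\<^sub>F t in at_top. 0 \<le> cut_distance M (flow W t) (\<lambda>_. 0)"
      using eventually_ge_at_top[of 0] by eventually_elim (rule cut_distance_zero_bounds(1)[OF gr])
    show "\<forall>\<^sub>F t in at_top. cut_distance M (flow W t) (\<lambda>_. 0) \<le> (LINT z|prod2. W z) * exp (- c * t)"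
      using eventually_ge_at_top[of 0]
      by eventually_elim (rule order_trans[OF cut_distance_zero_bounds(2)[OF gr] decay])
    have "((\<lambda>t. exp (- c * t)) \<longlongrightarrow> 0) at_top"
      using \<open>0 < c\<close> by (intro filterlim_compose[OF exp_at_bot])
        (auto intro!: filterlim_uminus_at_bot_at_top[THEN filterlim_compose]
            filterlim_tendsto_pos_mult_at_top[OF tendsto_const] filterlim_ident)
    then show "((\<lambda>t. (LINT z|prod2. W z) * exp (- c * t)) \<longlongrightarrow> 0) at_top"
      by (rule tendsto_mult_right_zero)
  qed simp
  moreover have "graphon M (\<lambda>_. 0)" by (auto simp: graphon_def kernel_def)
  ultimately show ?thesis using traj by (auto simp: has_dest_def)
qed

end

text \<open>The power of 2 secures positivity; the square-root expression is positive only for k >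
  192.\<close>

lemma threshold_bound_pos: "0 < threshold_bound k"
  by (simp add: threshold_bound_def less_max_iff_disj)

text \<open>The supremum defining the threshold ranges over p in [0, 1], so the bound has to lie
  there.\<close>

lemma threshold_bound_le_1:
  assumes "5 \<le> k"
  shows "threshold_bound k \<le> 1"
proof -
  have "2 powr (- 4 - 24 / (real k - 5)) \<le> 2 powr (0::real)"
    using assms order_trans[of "- 4" 0 "24 / (real k - 5)"] by (intro powr_mono) auto
  moreover have "0 \<le> sqrt (48 / real k)" by simp
  then have "1 / 2 - sqrt (48 / real k) \<le> 1" by linarith
  ultimately show ?thesis by (simp add: threshold_bound_def)
qed

theorem theorem7p4:
  fixes M :: "'a measure" and k :: nat
  assumes "prob_space M" and "atomless M" and "separable_sigma_algebra M"
    and "k \<ge> 5"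
  shows "density_threshold M k \<ge> threshold_bound k \<and> threshold_bound k > 0"
proof
  interpret prob_space M by fact
  show "threshold_bound k > 0" by (rule threshold_bound_pos)
  then show "density_threshold M k \<ge> threshold_bound k"
    unfolding density_threshold_def
    using has_dest_zero[OF _ _ assms(4)] threshold_bound_le_1[OF assms(4)]
    \<comment> \<open>The bound is itself an element of the set, which is bounded above by
      1.\<close>
    by (intro cSup_upper) (auto intro: bdd_aboveI[of _ 1])
qed

end
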